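(* Let $f\colon\mathbb{C}\to\mathbb{C}$ be a reduced quasiconformal mapping. Then for any $q>1$ the mapping $f$ has finite $\phi$-variation on lines, where $$\phi(t)=\frac{t}{(\log(e+1/t))^q}\ \text{ if } t>0,\qquad \phi(0)=0.$$
   Context: A homeomorphism $f\colon\mathbb{C}\to\mathbb{C}$ belonging to $W^{1,2}_{\mathrm{loc}}(\mathbb{C};\mathbb{C})$ is called reduced quasiconformal if there is a constant $0<k<1$ such that $|f_{\bar z}|\le k\,\operatorname{Re} f_z$ a.e. in $\mathbb{C}$, where $f_z=\tfrac12(f_x-if_y)$ and $f_{\bar z}=\tfrac12(f_x+if_y)$ are the (weak) complex derivatives. Let $\phi\colon[0,\infty)\to[0,\infty)$ be convex and strictly increasing with $\phi(0)=0$. For distinct points $a,b$ let $[a,b]$ be the closed line segment with endpoints $a,b$; a partition $0=t_0<t_1<\dots<t_N=1$ induces the partition $a_j=a+t_j(b-a)$, $j=0,\dots,N$, of $[a,b]$. A mapping $f$ on $[a,b]$ has finite $\phi$-variation on $[a,b]$ if $\sup\sum_{j=1}^N\phi(|f(a_j)-f(a_{j-1})|)<\infty$, the supremum being over all $N\ge1$ and all partitions $(a_j)_{j=0}^N$ of $[a,b]$. A mapping on a domain $\Omega$ has finite $\phi$-variation on lines if its restriction to every compact line segment contained in $\Omega$ has finite $\phi$-variation. *)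

theory Defs
  imports "HOL-Analysis.Analysis"
begin

section \<open>Sobolev maps of the plane\<close>

primrec C_k :: "nat \<Rightarrow> (complex \<Rightarrow> real) \<Rightarrow> bool" where
  "C_k 0 u \<longleftrightarrow> continuous_on UNIV u"
| "C_k (Suc k) u \<longleftrightarrow> (\<exists>ux uy. (\<forall>z. (u has_derivative (\<lambda>h. Re h * ux z + Im h * uy z)) (at z))
      \<and> C_k k ux \<and> C_k k uy)"

definition test_function :: "(complex \<Rightarrow> real) \<Rightarrow> bool" where
  "test_function u \<longleftrightarrow> (\<forall>k. C_k k u) \<and> compact (closure {z. u z \<noteq> 0})"

definition L1_loc :: "(complex \<Rightarrow> complex) \<Rightarrow> bool" where
  "L1_loc g \<longleftrightarrow> (\<forall>K. compact K \<longrightarrow> set_integrable lebesgue K g)"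

definition L2_loc :: "(complex \<Rightarrow> complex) \<Rightarrow> bool" where
  "L2_loc g \<longleftrightarrow> g \<in> borel_measurable lebesgue \<and>
     (\<forall>K. compact K \<longrightarrow> set_integrable lebesgue K (\<lambda>z. (cmod (g z))\<^sup>2))"

text \<open>\<open>g\<close> is the weak derivative of \<open>f\<close> in the direction \<open>v\<close>. Local integrability is required
  explicitly because the Bochner integral of a non-integrable function is 0 by convention.\<close>

definition weak_derivative :: "complex \<Rightarrow> (complex \<Rightarrow> complex) \<Rightarrow> (complex \<Rightarrow> complex) \<Rightarrow> bool" where
  "weak_derivative v f g \<longleftrightarrow> L1_loc f \<and> L1_loc g \<and>
     (\<forall>u. test_function u \<longrightarrow>
        (LINT z|lebesgue. frechet_derivative u (at z) v *\<^sub>R f z) = - (LINT z|lebesgue. u z *\<^sub>R g z))"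

text \<open>\<open>f\<close> belongs to \<open>W\<^sup>1\<^sup>,\<^sup>2\<close> locally, with weak partial derivatives \<open>fx\<close> and \<open>fy\<close>, which are
  determined only up to null sets.\<close>

definition W12_loc_with ::
    "(complex \<Rightarrow> complex) \<Rightarrow> (complex \<Rightarrow> complex) \<Rightarrow> (complex \<Rightarrow> complex) \<Rightarrow> bool" where
  "W12_loc_with f fx fy \<longleftrightarrow> L2_loc f \<and> L2_loc fx \<and> L2_loc fy \<and>
     weak_derivative 1 f fx \<and> weak_derivative \<i> f fy"

definition wirtinger :: "complex \<Rightarrow> complex \<Rightarrow> complex" where
  "wirtinger px py = (px - \<i> * py) / 2"

definition wirtinger_bar :: "complex \<Rightarrow> complex \<Rightarrow> complex" where
  "wirtinger_bar px py = (px + \<i> * py) / 2"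

definition reduced_quasiconformal :: "(complex \<Rightarrow> complex) \<Rightarrow> bool" where
  "reduced_quasiconformal f \<longleftrightarrow>
     (\<exists>g. homeomorphism UNIV UNIV f g) \<and>
     (\<exists>fx fy. W12_loc_with f fx fy \<and>
        (\<exists>k. 0 < k \<and> k < 1 \<and>
          (AE z in lebesgue. cmod (wirtinger_bar (fx z) (fy z)) \<le> k * Re (wirtinger (fx z) (fy z)))))"

section \<open>Variation along line segments\<close>

text \<open>The gauge condition is not part of the definitions of finite variation below; the gauge
  \<open>log_gauge q\<close> is shown to satisfy it in \<open>variation_gauge_log_gauge\<close>.\<close>

definition variation_gauge :: "(real \<Rightarrow> real) \<Rightarrow> bool" where
  "variation_gauge \<phi> \<longleftrightarrow> convex_on {0..} \<phi> \<and> strict_mono_on {0..} \<phi> \<and> \<phi> 0 = 0"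

definition unit_partition :: "nat \<Rightarrow> (nat \<Rightarrow> real) \<Rightarrow> bool" where
  "unit_partition N t \<longleftrightarrow> 1 \<le> N \<and> t 0 = 0 \<and> t N = 1 \<and> (\<forall>j<N. t j < t (Suc j))"

definition finite_variation_on_segment ::
    "(real \<Rightarrow> real) \<Rightarrow> (complex \<Rightarrow> complex) \<Rightarrow> complex \<Rightarrow> complex \<Rightarrow> bool" where
  "finite_variation_on_segment \<phi> f a b \<longleftrightarrow>
     bdd_above {\<Sum>j=1..N. \<phi> (cmod (f (a + t j *\<^sub>R (b - a)) - f (a + t (j - 1) *\<^sub>R (b - a)))) | N t.
       unit_partition N t}"

definition finite_variation_on_lines ::
    "(real \<Rightarrow> real) \<Rightarrow> (complex \<Rightarrow> complex) \<Rightarrow> complex set \<Rightarrow> bool" where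
  "finite_variation_on_lines \<phi> f \<Omega> \<longleftrightarrow>
     (\<forall>a b. a \<noteq> b \<and> closed_segment a b \<subseteq> \<Omega> \<longrightarrow> finite_variation_on_segment \<phi> f a b)"

definition log_gauge :: "real \<Rightarrow> real \<Rightarrow> real" where
  "log_gauge q t = (if t > 0 then t / (ln (exp 1 + 1 / t)) powr q else 0)"

lemma log_arg_gt_1:
  fixes t :: real assumes "t > 0" shows "ln (exp 1 + 1 / t) > 1"
proof -
  have "ln (exp 1) < ln (exp 1 + 1 / t)" using assms by (subst ln_less_cancel_iff) (auto intro: add_pos_pos)
  then show ?thesis by simp
qed

lemma log_factor_mono:
  fixes s t q :: real assumes "0 < s" "s < t" "q > 0"
  shows "1 / ln (exp 1 + 1 / s) powr q < 1 / ln (exp 1 + 1 / t) powr q"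
proof -
  have pos: "0 < exp 1 + 1 / t" "0 < exp 1 + 1 / s" using assms by (auto intro: add_pos_pos)
  have "1 / t < 1 / s" using assms by (simp add: frac_less2)
  then have "ln (exp 1 + 1 / t) < ln (exp 1 + 1 / s)" using pos by simp
  moreover have "ln (exp 1 + 1 / t) > 1" using assms by (intro log_arg_gt_1) auto
  ultimately have "ln (exp 1 + 1 / t) powr q < ln (exp 1 + 1 / s) powr q"
    using assms by (intro powr_less_mono2) auto
  then show ?thesis using log_arg_gt_1[of s] log_arg_gt_1[of t] assms
    by (intro divide_strict_left_mono mult_pos_pos) auto
qed

lemma log_gauge_strict_mono:
  assumes "q > 0" shows "strict_mono_on {0..} (log_gauge q)"
proof (rule strict_mono_onI)
  fix s t :: real assume st: "s \<in> {0..}" "t \<in> {0..}" "s < t"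
  have lt: "ln (exp 1 + 1 / t) > 1" using st by (intro log_arg_gt_1) auto
  show "log_gauge q s < log_gauge q t"
  proof (cases "s = 0")
    case True
    then show ?thesis using st lt by (simp add: log_gauge_def)
  next
    case False
    then have s: "0 < s" using st by auto
    have "s * (1 / ln (exp 1 + 1 / s) powr q) < t * (1 / ln (exp 1 + 1 / t) powr q)"
      using s st log_factor_mono[OF s st(3) assms] lt
      by (intro mult_strict_mono) auto
    then show ?thesis using s st by (simp add: log_gauge_def)
  qed
qed

lemma log_gauge_convex_pos:
  assumes q: "q > 0" shows "convex_on {0<..} (log_gauge q)"
proof -
  define L where "L = (\<lambda>t::real. ln (exp 1 + 1 / t))"
  define F where "F = (\<lambda>t::real. t * L t powr (-q))"
  define F1 where "F1 = (\<lambda>t::real. L t powr (-q) + q * L t powr (-q-1) / (exp 1 * t + 1))"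
  define F2 where "F2 = (\<lambda>t::real. q * L t powr (-q-1) / (t * (exp 1 * t + 1)^2) * (1 + (q+1) / L t))"
  have L1: "L t > 1" if "t > 0" for t using log_arg_gt_1[OF that] by (simp add: L_def)
  have p: "exp 1 * t + 1 > 0" if "t > 0" for t :: real using that by (auto intro: add_pos_pos)
  have dL: "(L has_real_derivative (- 1 / (t * (exp 1 * t + 1)))) (at t)" if "t > 0" for t
  proof -
    have "0 < exp 1 + 1 / t" using that by (auto intro: add_pos_pos)
    then have "(L has_real_derivative (1 / (exp 1 + 1 / t) * (- 1 / t^2))) (at t)"
      unfolding L_def using that
      by (auto intro!: derivative_eq_intros simp: power2_eq_square)
    moreover have "1 / (exp 1 + 1 / t) * (- 1 / t^2) = - 1 / (t * (exp 1 * t + 1))"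
    proof -
      have "(exp 1 + 1 / t) * t^2 = t * (exp 1 * t + 1)"
        using that by (simp add: field_simps power2_eq_square)
      then show ?thesis by simp
    qed
    ultimately show ?thesis by simp
  qed
  have dP: "((\<lambda>t. L t powr r) has_real_derivative (- r * L t powr (r-1) / (t * (exp 1 * t + 1)))) (at t)"
    if "t > 0" for t r
    by (rule DERIV_cong[OF DERIV_fun_powr[OF dL[OF that]]]) (use L1[OF that] in auto)
  have "convex_on {0<..} F"
  proof (rule f''_ge0_imp_convex)
    show "convex ({0<..} :: real set)" by simp
    show "(F has_real_derivative F1 t) (at t)" if "t \<in> {0<..}" for t
    proof -
      have "t > 0" using that by simp
      then show ?thesis unfolding F_def F1_def using p[of t] L1[of t]
        by (auto intro!: DERIV_cong[OF DERIV_mult[OF DERIV_ident dP]])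
    qed
    show "(F1 has_real_derivative F2 t) (at t)" if "t \<in> {0<..}" for t
    proof -
      have t: "t > 0" using that by simp
      define M where "M = L t powr (-q-1)"
      define D where "D = exp 1 * t + 1"
      have D: "D > 0" using p[OF t] by (simp add: D_def)
      have "-q-2 = (-q-1) - 1" by simp
      then have M2: "L t powr (-q-2) = M / L t"
        using L1[OF t] by (simp only: powr_diff M_def) simp
      have e: "-q-1-1 = -q-2" by simp
      have d1: "((\<lambda>t. L t powr (-q)) has_real_derivative q * M / (t * D)) (at t)"
        by (rule DERIV_cong[OF dP[OF t]]) (simp add: M_def D_def)
      have "((\<lambda>t. L t powr (-q-1)) has_real_derivative (q+1) * L t powr (-q-2) / (t * D)) (at t)"
        by (rule DERIV_cong[OF dP[OF t]], unfold e D_def) (simp add: add.commute)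
      from DERIV_cmult[OF this, of q]
      have d2: "((\<lambda>t. q * L t powr (-q-1)) has_real_derivative
          q * ((q+1) * L t powr (-q-2) / (t * D))) (at t)" .
      have d3: "((\<lambda>t. exp 1 * t + 1) has_real_derivative exp 1) (at t)"
        by (auto intro!: derivative_eq_intros)
      have "(F1 has_real_derivative
          (q * M / (t * D)
          + ((q * ((q+1) * L t powr (-q-2) / (t * D))) * D - q * M * exp 1) / (D * D))) (at t)"
        unfolding F1_def
        using DERIV_add[OF d1 DERIV_divide[OF d2 d3]] p[OF t] by (simp add: M_def D_def)
      moreover have "(q * M / (t * D)
          + ((q * ((q+1) * L t powr (-q-2) / (t * D))) * D - q * M * exp 1) / (D * D)) = F2 t"
      proof -
        have "q * M / (t * D) = q * M * D / (t * D^2)" using D t by (simp add: power2_eq_square)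
        moreover have "((q * ((q+1) * (M / L t) / (t * D))) * D - q * M * exp 1) / (D * D)
           = (q * (q+1) * (M / L t) - q * M * exp 1 * t) / (t * D^2)"
          using D t L1[OF t] by (simp add: field_simps power2_eq_square)
        ultimately have "(q * M / (t * D)
          + ((q * ((q+1) * (M / L t) / (t * D))) * D - q * M * exp 1) / (D * D))
          = (q * M * D + (q * (q+1) * (M / L t) - q * M * exp 1 * t)) / (t * D^2)"
          by (simp add: add_divide_distrib)
        also have "q * M * D + (q * (q+1) * (M / L t) - q * M * exp 1 * t) = q * M * (1 + (q+1) / L t)"
          by (simp add: D_def algebra_simps add_divide_distrib)
        finally show ?thesis unfolding M2 by (simp add: F2_def M_def D_def)
      qed
      ultimately show ?thesis by simp
    qed
    show "F2 t \<ge> 0" if "t \<in> {0<..}" for t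
      unfolding F2_def using that q L1[of t]
      by (intro mult_nonneg_nonneg divide_nonneg_nonneg add_nonneg_nonneg) auto
  qed
  moreover have "log_gauge q t = F t" if "t \<in> {0<..}" for t
    using that by (simp add: log_gauge_def F_def L_def powr_minus divide_inverse)
  moreover have "u * x + v * y > 0" if "x > 0" "y > 0" "u \<ge> 0" "v \<ge> 0" "u + v = 1" for x y u v :: real
  proof (cases "u = 0")
    case False
    then show ?thesis using that by (intro add_pos_nonneg) auto
  qed (use that in auto)
  ultimately show ?thesis by (simp add: convex_on_def)
qed

lemma log_gauge_0 [simp]: "log_gauge q 0 = 0"
  by (simp add: log_gauge_def)

lemma log_gauge_scale:
  assumes "q > 0" "0 < u" "u < 1" "t \<ge> 0" shows "log_gauge q (u * t) \<le> u * log_gauge q t"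
proof (cases "t = 0")
  case False
  then have t: "t > 0" using assms by simp
  then have "0 < u * t" "u * t < t" using assms by auto
  from log_factor_mono[OF this assms(1)]
  have "(u * t) * (1 / ln (exp 1 + 1 / (u * t)) powr q) \<le> (u * t) * (1 / ln (exp 1 + 1 / t) powr q)"
    using \<open>0 < u * t\<close> by (intro mult_left_mono) auto
  then show ?thesis using t \<open>0 < u * t\<close> by (simp add: log_gauge_def)
qed simp

lemma variation_gauge_log_gauge:
  assumes q: "q > 0" shows "variation_gauge (log_gauge q)"
proof -
  have "convex_on {0..} (log_gauge q)"
  proof (rule convex_onI)
    fix u x y :: real assume h: "0 < u" "u < 1" "x \<in> {0..}" "y \<in> {0..}"
    consider "x = 0" | "y = 0" | "x > 0" "y > 0" using h by force
    then show "log_gauge q ((1 - u) *\<^sub>R x + u *\<^sub>R y) \<le> (1 - u) * log_gauge q x + u * log_gauge q y"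
    proof cases
      case 3
      then show ?thesis using convex_onD[OF log_gauge_convex_pos[OF q], of u x y] h by simp
    qed (use h log_gauge_scale[OF q, of u y] log_gauge_scale[OF q, of "1 - u" x] in auto)
  qed simp
  then show ?thesis using log_gauge_strict_mono[OF q] by (simp add: variation_gauge_def)
qed

end

theory Submission
  imports Defs
begin

text \<open>
Let \<open>A\<close> and \<open>B\<close> be the derivatives of \<open>f\<close> with respect to \<open>z\<close> and its conjugate. The proof rests on two properties
of the condition \<open>\<bar>B\<bar> \<le> k * Re A\<close>. It describes a convex cone of
derivatives, and the cone is preserved when \<open>(d + \<i> * b) * z\<close> with \<open>d \<ge> 0\<close> and an arbitrary real \<open>b\<close> is added to \<open>f\<close>.
By convexity a mollification of \<open>f\<close> satisfies the condition at every point (\<open>smooth_approximation\<close>). After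
adding \<open>(d + \<i> * b) * z\<close> with \<open>d > 0\<close> it is strongly monotone, hence injective, and it is quasiconformal with a
constant that depends on \<open>k\<close> only. For such smooth maps the length-area method
gives \<open>\<bar>g (c - h) - g c\<bar> \<le> H * \<bar>g (c + h) - g c\<bar>\<close>, again with \<open>H\<close> depending on \<open>k\<close> only
(\<open>weak_quasisymmetry\<close>). In the limit this inequality holds for \<open>f + \<i> * b * z\<close> for every real \<open>b\<close>
(\<open>reduced_quasiconformal_quasisymmetry\<close>).

On a line let \<open>u\<close> and \<open>v\<close> be the components of \<open>f\<close> along the line and across it; \<open>u\<close> is nondecreasing. The free
parameter \<open>b\<close> may be used to cancel the increment of \<open>v\<close> over one interval. The inequality then says
that \<open>u\<close> is doubling and that second differences of \<open>v\<close> are bounded by increments of \<open>u\<close>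
(\<open>finite_variation_on_segmentI\<close>).

The rest concerns functions of one variable. Going through the dyadic scales, the increment of \<open>v\<close> over an interval of
length \<open>1/2^N\<close> is at most a sum over the scales \<open>k < N\<close> of averaged increments of \<open>u\<close>
(\<open>zygmund_pair_increments\<close>), and over a partition the terms of each scale add up to \<open>O(1)\<close>
(\<open>shifted_increments\<close>), because \<open>u\<close> is monotone. Thus the variation of \<open>v\<close> over dyadic intervals may grow linearly in
\<open>N\<close>, one unit per scale. As \<open>u\<close> is doubling, \<open>u\<close> and \<open>v\<close> are Hoelder continuous, so the logarithmic factor
of the gauge is of size \<open>(1 + N) powr (-q)\<close>. This leaves the series of \<open>(1 + k) powr (-q)\<close>, which
converges for \<open>q > 1\<close> (\<open>zygmund_pair_finite_variation\<close>).
\<close>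

section \<open>Monotone doubling functions and the Zygmund condition\<close>

text \<open>The functions \<open>u\<close> and \<open>v\<close> are the components of a map restricted to a line, along the line and
across it. The first inequality is a one-sided doubling condition for the measure with distribution
function \<open>u\<close>; the second is Zygmund's second-difference condition for \<open>v\<close>, with that measure in place
of Lebesgue measure.\<close>

definition zygmund_pair :: "real \<Rightarrow> (real \<Rightarrow> real) \<Rightarrow> (real \<Rightarrow> real) \<Rightarrow> bool" where
  "zygmund_pair H u v \<longleftrightarrow> mono u \<and> continuous_on UNIV u \<and> continuous_on UNIV v \<and>
   (\<forall>t s. s \<ge> 0 \<longrightarrow> u (t+s) - u t \<le> H * (u (t+2 * s) - u (t+s)) \<and>
     \<bar>v (t+2 * s) - 2 * v (t+s) + v t\<bar> \<le> H * (u (t+2 * s) - u t))"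

text \<open>All three estimates come from passing from the step \<open>r\<close> to the step \<open>2r\<close> with the base point \<open>t\<close> fixed.
Doubling says that the increment of \<open>u\<close> shrinks at least by the factor \<open>lam = H / (H + 1)\<close> when the step is
halved. Since the increment of \<open>v\<close> over \<open>r\<close> is half of the one over \<open>2r\<close> up to half of a second
difference, it is controlled by the increments of \<open>u\<close> at all larger scales: the last estimate keeps
this sum, the middle one inserts the geometric decay of the increments of \<open>u\<close>, for which \<open>H > 1\<close>, that is \<open>lam > 1/2\<close>, is used.\<close>

lemma zygmund_pair_increments:
  assumes Z: "zygmund_pair H u v" and H: "H > 1"
  defines "lam \<equiv> H / (H + 1)"
  assumes s: "s \<ge> 0" and B: "\<bar>v (t + 2^N * s) - v t\<bar> \<le> B" and A: "u (t + 2^N * s) - u t \<le> A"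
  shows "u (t+s) - u t \<le> lam^N * A"
    and "\<bar>v (t+s) - v t\<bar> \<le> lam^N * max B (H * A / (2*lam - 1))"
    and "\<bar>v (t+s) - v t\<bar> \<le> B / 2^N + H * (\<Sum>k<N. (u (t + 2^N * s/2^k) - u t) * 2^k / 2^N)"
proof -
  have lam: "0 < lam" "lam < 1" "1/2 < lam" using H by (auto simp: lam_def field_simps)
  have du: "u (t+r) - u t \<le> lam * (u (t+2*r) - u t)" if "r \<ge> 0" for r
  proof -
    have "u (t+r) - u t \<le> H * (u (t+2*r) - u (t+r))" using Z that by (simp add: zygmund_pair_def)
    then have "(H + 1) * (u (t+r) - u t) \<le> H * (u (t+2*r) - u t)" by (simp add: algebra_simps)
    then show ?thesis using H by (simp add: lam_def field_simps)
  qed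
  have dv: "\<bar>v (t+r) - v t\<bar> \<le> \<bar>v (t+2*r) - v t\<bar> / 2 + H * (u (t+2*r) - u t) / 2" if "r \<ge> 0" for r
  proof -
    have "\<bar>v (t+2*r) - 2 * v (t+r) + v t\<bar> \<le> H * (u (t+2*r) - u t)" using Z that by (simp add: zygmund_pair_def)
    moreover have "\<bar>p - o'\<bar> \<le> \<bar>w - o'\<bar> / 2 + X / 2" if "\<bar>w - 2 * p + o'\<bar> \<le> X" for p o' w X :: real
      using abs_le_D1[OF that] abs_le_D2[OF that] abs_ge_self[of "w - o'"] abs_ge_minus_self[of "w - o'"]
      by (intro abs_leI; argo)
    ultimately show ?thesis by blast
  qed
  have u: "u (t+r/2^n) - u t \<le> lam^n * (u (t+r) - u t)" if "r \<ge> 0" for r n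
  proof (induction n)
    case (Suc n)
    have "u (t+r/2^Suc n) - u t \<le> lam * (u (t+r/2^n) - u t)"
      using du[of "r/2^Suc n"] that by simp
    also have "\<dots> \<le> lam * (lam^n * (u (t+r) - u t))" using Suc lam by (intro mult_left_mono) auto
    finally show ?case by simp
  qed simp
  have uA: "u (t + (2^N * s)/2^n) - u t \<le> lam^n * A" for n
  proof -
    have "lam^n * (u (t + 2^N * s) - u t) \<le> lam^n * A" using A lam by (intro mult_left_mono) auto
    then show ?thesis using u[of "2^N * s" n] s by simp
  qed
  show "u (t+s) - u t \<le> lam^N * A" using uA[of N] by simp
  define C where "C = max B (H * A / (2*lam - 1))"
  have C: "B \<le> C" "H * A \<le> C * (2*lam-1)" using lam by (auto simp: C_def field_simps max_def)
  have "\<bar>v (t + (2^N * s)/2^n) - v t\<bar> \<le> lam^n * C" for n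
  proof (induction n)
    case 0
    then show ?case using B C by simp
  next
    case (Suc n)
    have "\<bar>v (t + (2^N * s)/2^Suc n) - v t\<bar> \<le> \<bar>v (t + (2^N * s)/2^n) - v t\<bar> / 2 + H * (u (t + (2^N * s)/2^n) - u t) / 2"
      using dv[of "(2^N * s)/2^Suc n"] s by simp
    also have "\<dots> \<le> lam^n * C / 2 + H * (lam^n * A) / 2"
      using Suc uA[of n] H by (intro add_mono divide_right_mono mult_left_mono) auto
    also have "\<dots> = lam^n * (C + H * A) / 2" by (simp add: algebra_simps)
    also have "\<dots> \<le> lam^n * (C + C * (2*lam-1)) / 2"
      using C lam by (intro divide_right_mono mult_left_mono) auto
    finally show ?case by (simp add: algebra_simps)
  qed
  from this[of N] show "\<bar>v (t+s) - v t\<bar> \<le> lam^N * max B (H * A / (2*lam - 1))"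
    by (simp add: C_def)
  have "\<bar>v (t + (2^N * s)/2^n) - v t\<bar> \<le> B / 2^n + H * (\<Sum>k<n. (u (t + 2^N * s/2^k) - u t) * 2^k / 2^n)" for n
  proof (induction n)
    case 0
    then show ?case using B by simp
  next
    case (Suc n)
    have "\<bar>v (t + (2^N * s)/2^Suc n) - v t\<bar> \<le> \<bar>v (t + (2^N * s)/2^n) - v t\<bar> / 2 + H * (u (t + (2^N * s)/2^n) - u t) / 2"
      using dv[of "(2^N * s)/2^Suc n"] s by simp
    also have "\<dots> \<le> (B / 2^n + H * (\<Sum>k<n. (u (t + 2^N * s/2^k) - u t) * 2^k / 2^n)) / 2 + H * (u (t + (2^N * s)/2^n) - u t) / 2"
      using Suc by simp
    also have "\<dots> = B / 2^Suc n + H * (\<Sum>k<Suc n. (u (t + 2^N * s/2^k) - u t) * 2^k / 2^Suc n)"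
      by (simp add: sum_divide_distrib[symmetric] field_simps)
    finally show ?case .
  qed
  from this[of N] show "\<bar>v (t+s) - v t\<bar> \<le> B / 2^N + H * (\<Sum>k<N. (u (t + 2^N * s/2^k) - u t) * 2^k / 2^N)"
    by simp
qed

text \<open>At a fixed scale \<open>d\<close> the averaged increments of \<open>u\<close> over a partition add up to \<open>O(d)\<close>: the term of the
interval \<open>I\<close> is at most the integral over \<open>I\<close> of \<open>u (x + d) - u (x - d)\<close>, and the integral of this
difference over \<open>[0, 1]\<close> is at most \<open>2d\<close> times an oscillation of \<open>u\<close>. Intervals longer than \<open>d\<close>
do not fit into this comparison and are left out.\<close>

lemma shifted_increments:
  fixes u :: "real \<Rightarrow> real"
  assumes u: "mono u" "continuous_on UNIV u" and d: "d \<ge> 0" "d \<le> 2"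
    and P: "unit_partition n t"
  shows "(\<Sum>j=1..n. if t j - t (j-1) \<le> d then (t j - t (j-1)) * (u (t (j-1) + d) - u (t (j-1))) else 0) \<le> 2 * d * (u 3 - u (-2))"
proof -
  have isCont: "isCont u x" for x using u(2) by (simp add: continuous_on_eq_continuous_at)
  obtain U where "\<forall>x\<in>{-10..10}. (U has_real_derivative u x) (at x within {-10..10})"
    using antiderivative_continuous[of "-10" 10 u] continuous_on_subset[OF u(2)]
    by (metis subset_UNIV has_real_derivative_iff_has_vector_derivative atLeastAtMost_iff)
  then have U: "(U has_real_derivative u x) (at x)" if "-10 < x" "x < 10" for x
    using that at_within_Icc_at[of "-10" x 10] by (metis atLeastAtMost_iff less_imp_le)
  \<comment> \<open>the primitive of \<open>u (x + d) - u (x - d)\<close>, whose increments telescope\<close>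
  define W where "W x = U (x + d) - U (x - d)" for x
  have W: "(W has_real_derivative u (x+d) - u (x-d)) (at x)" if "0 \<le> x" "x \<le> 1" for x
    unfolding W_def using that d
    by (auto intro!: derivative_eq_intros DERIV_chain2[OF U])
  have t: "t j < t (Suc j)" if "j < n" for j using P that by (simp add: unit_partition_def)
  have tm: "t i \<le> t j" if "i \<le> j" "j \<le> n" for i j
    using that
  proof (induction j)
    case (Suc j)
    then show ?case using t[of j] by (cases "i = Suc j") auto
  qed simp
  have t01: "0 \<le> t j" "t j \<le> 1" if "j \<le> n" for j
    using tm[of 0 j] tm[of j n] that P by (auto simp: unit_partition_def)
  have inc: "(if t j - t (j-1) \<le> d then (t j - t (j-1)) * (u (t (j-1) + d) - u (t (j-1))) else 0)
      \<le> W (t j) - W (t (j-1))" if j: "j \<in> {1..n}" for j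
  proof -
    have lt: "t (j-1) < t j" using t[of "j-1"] j by (cases j) auto
    have b: "0 \<le> t (j-1)" "t j \<le> 1" using t01[of "j-1"] t01[of j] j by auto
    have "\<exists>x>t (j-1). x < t j \<and> W (t j) - W (t (j-1)) = (t j - t (j-1)) * (u (x+d) - u (x-d))"
      using lt j by (intro MVT2 W) (use b in auto)
    then obtain x where x: "t (j-1) < x" "x < t j" "W (t j) - W (t (j-1)) = (t j - t (j-1)) * (u (x+d) - u (x-d))"
      by auto
    have "u (x+d) - u (x-d) \<ge> 0" using u(1) d by (simp add: monoD)
    moreover have "u (t (j-1) + d) - u (t (j-1)) \<le> u (x+d) - u (x-d)" if "t j - t (j-1) \<le> d"
      using u(1) x that by (intro diff_mono monoD[OF u(1)]) auto
    ultimately show ?thesis using x lt by (auto intro: mult_left_mono)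
  qed
  have "(\<Sum>j=1..n. if t j - t (j-1) \<le> d then (t j - t (j-1)) * (u (t (j-1) + d) - u (t (j-1))) else 0)
      \<le> (\<Sum>j=1..n. W (t j) - W (t (j-1)))" by (intro sum_mono inc)
  also have "\<dots> = W (t n) - W (t 0)"
    by (subst sum_telescope''[symmetric]) (use P in \<open>auto simp: unit_partition_def\<close>)
  also have "\<dots> = W 1 - W 0" using P by (simp add: unit_partition_def)
  also have "\<dots> \<le> 2 * d * (u 3 - u (-2))"
  proof (cases "d = 0")
    case False
    then have d0: "d > 0" using d by simp
    have "\<exists>x>1-d. x < 1+d \<and> U (1+d) - U (1-d) = (1+d - (1-d)) * u x"
      using d0 d by (intro MVT2 U) auto
    then obtain x where x: "1-d < x" "x < 1+d" "U (1+d) - U (1-d) = 2*d*u x" by auto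
    have "\<exists>y>0-d. y < 0+d \<and> U (0+d) - U (0-d) = (0+d - (0-d)) * u y"
      using d0 d by (intro MVT2 U) auto
    then obtain y where y: "-d < y" "y < d" "U d - U (-d) = 2*d*u y" by auto
    have "W 1 - W 0 = 2*d*(u x - u y)" using x y by (simp add: W_def algebra_simps)
    also have "\<dots> \<le> 2*d*(u 3 - u (-2))"
      using d d0 x y by (intro mult_left_mono diff_mono monoD[OF u(1)]) auto
    finally show ?thesis .
  qed (simp add: W_def)
  finally show ?thesis .
qed

text \<open>An increment that decays geometrically with the dyadic scale \<open>N\<close> makes the logarithm in the gauge
grow linearly in \<open>N\<close>. The summand \<open>exp 1\<close>, which gives \<open>ln (exp 1 + 1 / x) \<ge> 1\<close>, takes care
of the scales at which the bound on \<open>x\<close> is still larger than 1.\<close>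

lemma log_factor_lower_bound:
  fixes lam C :: real
  assumes lam: "0 < lam" "lam < 1" and C: "C \<ge> 1"
  shows "\<exists>c>0. \<forall>N x. 0 < x \<longrightarrow> x \<le> C * lam ^ N \<longrightarrow> c * (1 + real N) \<le> ln (exp 1 + 1 / x)"
proof -
  define a where "a = - ln lam"
  define b where "b = ln C"
  have a: "a > 0" and b: "b \<ge> 0" using lam C by (auto simp: a_def b_def)
  define c where "c = min 1 (a / (1 + b)) / 2"
  have "c > 0" using a b by (simp add: c_def)
  moreover have "c * (1 + real N) \<le> ln (exp 1 + 1 / x)" if x: "0 < x" "x \<le> C * lam ^ N" for N x
  proof -
  define X where "X = ln (exp 1 + 1 / x)"
  have X1: "X \<ge> 1" using log_arg_gt_1[OF x(1)] by (simp add: X_def)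
  have "ln x \<le> ln (C * lam ^ N)" using x by (intro ln_mono) auto
  also have "\<dots> = b - N * a" using C lam by (simp add: a_def b_def ln_mult ln_realpow)
  finally have "N * a - b \<le> ln (1 / x)" using x by (simp add: ln_div)
  also have "\<dots> \<le> X" unfolding X_def using x by (intro ln_mono) auto
  finally have "N * a \<le> X + b * 1" by simp
  also have "\<dots> \<le> X + b * X" using X1 b by (intro add_left_mono mult_left_mono) auto
  finally have "N * a / (1 + b) \<le> X" using b by (simp add: field_simps)
  moreover have "2 * c \<le> 1" "2 * c \<le> a / (1 + b)" by (auto simp: c_def)
  moreover from this(2) have "2 * c * N \<le> a / (1 + b) * N" by (rule mult_right_mono) simp
  ultimately have "2 * c + 2 * c * N \<le> 2 * X" using X1 by (simp add: mult.commute)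
  then show ?thesis by (simp add: X_def algebra_simps)
  qed
  ultimately show ?thesis by blast
qed

lemma log_gauge_le:
  assumes "0 \<le> x" "x \<le> y" "q > 0" "0 < m" "x > 0 \<Longrightarrow> m \<le> ln (exp 1 + 1 / x)"
  shows "log_gauge q x \<le> y * m powr (-q)"
proof (cases "x = 0")
  case False
  then have x: "x > 0" using assms by simp
  have "m powr q \<le> ln (exp 1 + 1 / x) powr q" using assms x by (intro powr_mono2) auto
  then have "x / ln (exp 1 + 1 / x) powr q \<le> y / m powr q"
    using assms x by (intro frac_le) auto
  then show ?thesis using x by (simp add: log_gauge_def powr_minus divide_inverse)
qed (use assms in auto)

text \<open>An interval of a partition of \<open>[0, 1]\<close> whose length is about \<open>1/2^N\<close> receives from the gauge the factor
\<open>(1 + N) powr (-q)\<close>, which is at most \<open>(1 + k) powr (-q)\<close> for every coarser scale \<open>k\<close>. Its increment is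
bounded by a sum of terms, one for each coarser scale \<open>k\<close>, and for fixed \<open>k\<close> these terms add up to a
constant over the whole partition. What remains is the series of \<open>(1 + k) powr (-q)\<close>, which
converges because \<open>q > 1\<close>.\<close>

lemma zygmund_pair_finite_variation:
  assumes Z: "zygmund_pair H u v" and H: "H > 1" and q: "q > 1"
  shows "\<exists>K. \<forall>n t. unit_partition n t \<longrightarrow>
    (\<Sum>j=1..n. log_gauge q (cmod (Complex (u (t j)) (v (t j)) - Complex (u (t (j-1))) (v (t (j-1)))))) \<le> K"
proof -
  define lam where "lam = H / (H + 1)"
  have lam: "0 < lam" "lam < 1" using H by (auto simp: lam_def field_simps)
  have u: "mono u" "continuous_on UNIV u" and v: "continuous_on UNIV v" using Z by (auto simp: zygmund_pair_def)
  have um: "u x \<le> u y" if "x \<le> y" for x y using u(1) that by (rule monoD)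
  define A where "A = u 3 - u (-2)"
  have A: "A \<ge> 0" by (simp add: A_def um)
  have "compact (v ` {0..3})" using v by (intro compact_continuous_image) (auto intro: continuous_on_subset)
  then have "bounded (v ` {0..3})" by (rule compact_imp_bounded)
  then obtain B' where "\<forall>y\<in>v ` {0..3}. norm y \<le> B'" unfolding bounded_iff by (rule exE)
  then have B': "\<bar>v x\<bar> \<le> B'" if "x \<in> {0..3}" for x using that by simp
  define B where "B = 2 * B'"
  have B: "\<bar>v x - v y\<bar> \<le> B" if "x \<in> {0..3}" "y \<in> {0..3}" for x y
    using B'[OF that(1)] B'[OF that(2)] by (simp add: B_def)
  have B0: "B \<ge> 0" using B[of 0 0] by simp
  define C where "C = max 1 (A + max B (H * A / (2*lam - 1)))"
  have "C \<ge> 1" by (simp add: C_def)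
  from log_factor_lower_bound[OF lam this] obtain c where c: "c > 0"
    "\<forall>N x. 0 < x \<longrightarrow> x \<le> C * lam ^ N \<longrightarrow> c * (1 + real N) \<le> ln (exp 1 + 1 / x)" by blast
  have "summable (\<lambda>k. real k powr (-q))" using q by (simp add: summable_real_powr_iff)
  then have "summable (\<lambda>k. real (Suc k) powr (-q))"
    using summable_Suc_iff[of "\<lambda>k. real k powr (-q)"] by blast
  then have sm: "summable (\<lambda>k. (1 + real k) powr (-q))" by (simp add: add.commute)
  define S where "S = (\<Sum>k. (1 + real k) powr (-q))"
  have S: "(\<Sum>k<M. (1 + real k) powr (-q)) \<le> S" for M
    unfolding S_def by (intro sum_le_suminf sm) auto
  define d where "d = (\<lambda>k::nat. 2 / 2^k :: real)"
  show ?thesis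
  proof (intro exI allI impI)
    fix n t assume P: "unit_partition n t"
    define l where "l = (\<lambda>j. t j - t (j-1))"
    define T where "T = (\<lambda>j k. if l j \<le> d k then l j * (u (t (j-1) + d k) - u (t (j-1))) else 0)"
    define G where "G = (\<lambda>j. cmod (Complex (u (t j)) (v (t j)) - Complex (u (t (j-1))) (v (t (j-1)))))"
    have t: "t j < t (Suc j)" if "j < n" for j using P that by (simp add: unit_partition_def)
    have tm: "t i \<le> t j" if "i \<le> j" "j \<le> n" for i j
      using that
  proof (induction j)
    case (Suc j)
    then show ?case using t[of j] by (cases "i = Suc j") auto
  qed simp
    have t01: "0 \<le> t j" "t j \<le> 1" if "j \<le> n" for j
      using tm[of 0 j] tm[of j n] that P by (auto simp: unit_partition_def)
    have l: "0 < l j" "l j \<le> 1" if "j \<in> {1..n}" for j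
    proof -
      have "j - 1 < n" "Suc (j - 1) = j" "j \<le> n" using that by auto
      then show "0 < l j" "l j \<le> 1" using t[of "j-1"] t01[of j] t01[of "j-1"] by (auto simp: l_def)
    qed
    have T0: "T j k \<ge> 0" if "j \<in> {1..n}" for j k
      using l[OF that] u(1) by (auto simp: T_def d_def intro!: mult_nonneg_nonneg um)
    have one: "\<exists>N. log_gauge q (G j) \<le> c powr (-q) *
        ((u (t j) - u (t (j-1))) + B * l j + H * (\<Sum>k<N. (1 + real k) powr (-q) * 2^k * T j k))"
      if j: "j \<in> {1..n}" for j
    proof -
      define s where "s = t (j-1)"
      define r where "r = l j"
      have r: "0 < r" "r \<le> 1" and tj: "t j = s + r" using l[OF j] by (auto simp: r_def s_def l_def)
      have s: "0 \<le> s" "s \<le> 1" using t01[of "j-1"] j unfolding s_def by force+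
      obtain N0 where "1 / r < 2 ^ N0" using real_arch_pow[of 2 "1/r"] by auto
      then have ex: "1 \<le> 2 ^ N0 * r" using r by (simp add: field_simps)
      \<comment> \<open>the dyadic scale of the interval: \<open>2^N * r\<close> lies between 1 and 2\<close>
      define N where "N = (LEAST N. 1 \<le> 2 ^ N * r)"
      have N1: "1 \<le> 2 ^ N * r" unfolding N_def using ex by (rule LeastI)
      have N2: "2 ^ N * r \<le> 2"
      proof (cases N)
        case (Suc m)
        have "\<not> 1 \<le> 2 ^ m * r" using not_less_Least[of m "\<lambda>N. 1 \<le> 2 ^ N * r"] Suc by (simp add: N_def)
        then show ?thesis using Suc by simp
      qed (use r in simp)
      have bB: "\<bar>v (s + 2^N*r) - v s\<bar> \<le> B" using s N1 N2 by (intro B) auto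
      have bA: "u (s + 2^N*r) - u s \<le> A"
        unfolding A_def using s N2 u(1) by (intro diff_mono um) auto
      note I = zygmund_pair_increments[OF Z H _ bB bA, folded lam_def, OF less_imp_le[OF r(1)]]
      have du0: "u (s+r) - u s \<ge> 0" using r by (simp add: um)
      have Gle: "G j \<le> (u (s+r) - u s) + \<bar>v (s+r) - v s\<bar>"
        using cmod_le[of "Complex (u (s+r)) (v (s+r)) - Complex (u s) (v s)"] du0
        by (simp add: G_def tj s_def)
      also have "\<dots> \<le> lam^N * A + lam^N * max B (H * A / (2*lam - 1))" using I by (intro add_mono) auto
      also have "\<dots> = (A + max B (H * A / (2*lam - 1))) * lam ^ N" by (simp add: distrib_right mult.commute[of "lam^N"])
      also have "\<dots> \<le> C * lam ^ N" using lam by (intro mult_right_mono) (auto simp: C_def)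
      finally have GC: "G j \<le> C * lam ^ N" .
      have rN: "1 / 2^N \<le> r" using N1 by (simp add: field_simps)
      define Q where "Q = (1 + real N) powr (-q)"
      have Q: "0 \<le> Q" "Q \<le> 1" using q powr_mono2'[of "-q" 1 "1 + real N"] by (auto simp: Q_def)
      have Qk: "Q \<le> (1 + real k) powr (-q)" if "k < N" for k
        unfolding Q_def using q that by (intro powr_mono2') auto
      have scale: "Q * ((u (s + 2^N*r/2^k) - u s) * 2^k / 2^N) \<le> (1 + real k) powr (-q) * 2^k * T j k" if k: "k < N" for k
      proof -
        have "r \<le> 2 / 2^N" using N2 by (simp add: field_simps)
        also have "\<dots> \<le> d k" unfolding d_def using k by (intro divide_left_mono) auto
        finally have Teq: "T j k = r * (u (s + d k) - u s)" by (simp add: T_def r_def s_def)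
        have "(u (s + 2^N*r/2^k) - u s) * (1 / 2^N) \<le> (u (s + d k) - u s) * r"
          using rN N2 r u(1) by (intro mult_mono diff_right_mono um) (auto simp: d_def divide_right_mono um)
        then have "2^k * ((u (s + 2^N*r/2^k) - u s) * (1 / 2^N)) \<le> 2^k * T j k"
          unfolding Teq by (intro mult_left_mono) (auto simp: mult.commute)
        moreover have "0 \<le> 2^k * T j k" using T0[OF j] by simp
        ultimately show ?thesis
          using mult_mono[OF Qk[OF k], of "2^k * ((u (s + 2^N*r/2^k) - u s) * (1 / 2^N))" "2^k * T j k"] r
          by (simp add: mult_ac um)
      qed
      have "log_gauge q (G j) \<le> ((u (s+r) - u s) + \<bar>v (s+r) - v s\<bar>) * (c * (1 + real N)) powr (-q)"
        using Gle c(2)[rule_format, OF _ GC] c(1) q by (intro log_gauge_le) (auto simp: G_def)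
      also have "\<dots> = c powr (-q) * (Q * (u (s+r) - u s) + Q * \<bar>v (s+r) - v s\<bar>)"
      proof -
        have "(c * (1 + real N)) powr (-q) = c powr (-q) * Q" using c(1) by (simp add: powr_mult Q_def)
        then show ?thesis by (simp only: distrib_left distrib_right mult_ac)
      qed
      also have "\<dots> \<le> c powr (-q) * ((u (s+r) - u s) + B * r + H * (\<Sum>k<N. (1 + real k) powr (-q) * 2^k * T j k))"
      proof (intro mult_left_mono)
        have "Q * (u (s+r) - u s) \<le> u (s+r) - u s" using Q du0 by (simp add: mult_left_le_one_le)
        moreover have "Q * \<bar>v (s+r) - v s\<bar> \<le> Q * (B / 2^N + H * (\<Sum>k<N. (u (s + 2^N*r/2^k) - u s) * 2^k / 2^N))"
          using I(3) Q by (intro mult_left_mono)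
        moreover have "\<dots> = Q * (B * (1 / 2^N)) + H * (\<Sum>k<N. Q * ((u (s + 2^N*r/2^k) - u s) * 2^k / 2^N))"
          by (simp add: distrib_left sum_distrib_left mult_ac)
        moreover have "\<dots> \<le> 1 * (B * r) + H * (\<Sum>k<N. (1 + real k) powr (-q) * 2^k * T j k)"
        proof (rule add_mono)
          show "Q * (B * (1 / 2^N)) \<le> 1 * (B * r)" using Q B0 rN by (intro mult_mono) auto
          show "H * (\<Sum>k<N. Q * ((u (s + 2^N*r/2^k) - u s) * 2^k / 2^N)) \<le> H * (\<Sum>k<N. (1 + real k) powr (-q) * 2^k * T j k)"
            using H by (intro mult_left_mono sum_mono scale) auto
        qed
        ultimately show "Q * (u (s+r) - u s) + Q * \<bar>v (s+r) - v s\<bar> \<le> (u (s+r) - u s) + B * r + H * (\<Sum>k<N. (1 + real k) powr (-q) * 2^k * T j k)"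
          by linarith
      qed auto
      finally show ?thesis
        by (intro exI[of _ N]) (simp only: tj s_def[symmetric] r_def[symmetric])
    qed
    have "\<exists>N. \<forall>j\<in>{1..n}. log_gauge q (G j) \<le> c powr (-q) *
        ((u (t j) - u (t (j-1))) + B * l j + H * (\<Sum>k<N j. (1 + real k) powr (-q) * 2^k * T j k))"
      by (rule bchoice) (use one in blast)
    then obtain N where N: "\<forall>j\<in>{1..n}. log_gauge q (G j) \<le> c powr (-q) *
        ((u (t j) - u (t (j-1))) + B * l j + H * (\<Sum>k<N j. (1 + real k) powr (-q) * 2^k * T j k))"
      by (rule exE)
    \<comment> \<open>any common bound for the finitely many scales that occur\<close>
    define M where "M = (\<Sum>j=1..n. N j)"
    have M: "N j \<le> M" if "j \<in> {1..n}" for j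
      unfolding M_def using that by (intro member_le_sum) auto
    have "(\<Sum>j=1..n. log_gauge q (G j)) \<le> (\<Sum>j=1..n. c powr (-q) *
        ((u (t j) - u (t (j-1))) + B * l j + H * (\<Sum>k<M. (1 + real k) powr (-q) * 2^k * T j k)))"
    proof (rule sum_mono)
      fix j assume j: "j \<in> {1..n}"
      have "(\<Sum>k<N j. (1 + real k) powr (-q) * 2^k * T j k) \<le> (\<Sum>k<M. (1 + real k) powr (-q) * 2^k * T j k)"
        using M[OF j] T0[OF j] by (intro sum_mono2) auto
      then show "log_gauge q (G j) \<le> c powr (-q) *
        ((u (t j) - u (t (j-1))) + B * l j + H * (\<Sum>k<M. (1 + real k) powr (-q) * 2^k * T j k))"
        using H by (intro order_trans[OF N[rule_format, OF j]] mult_left_mono add_left_mono) auto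
    qed
    also have "\<dots> = c powr (-q) * ((\<Sum>j=1..n. u (t j) - u (t (j-1))) + B * (\<Sum>j=1..n. l j)
        + H * (\<Sum>k<M. (1 + real k) powr (-q) * 2^k * (\<Sum>j=1..n. T j k)))"
    proof -
      have "(\<Sum>j=1..n. \<Sum>k<M. (1 + real k) powr (-q) * 2^k * T j k) = (\<Sum>k<M. \<Sum>j=1..n. (1 + real k) powr (-q) * 2^k * T j k)"
        by (rule sum.swap)
      then show ?thesis by (simp add: sum.distrib sum_distrib_left[symmetric])
    qed
    also have "\<dots> \<le> c powr (-q) * (A + B * 1 + H * (4 * A * S))"
    proof (intro mult_left_mono add_mono)
      have "(\<Sum>j=1..n. u (t j) - u (t (j-1))) = u (t n) - u (t 0)"
        using sum_telescope''[of 0 n "\<lambda>j. u (t j)"] by simp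
      then show "(\<Sum>j=1..n. u (t j) - u (t (j-1))) \<le> A"
        unfolding A_def using P u(1) by (auto simp: unit_partition_def intro!: diff_mono um)
      have "(\<Sum>j=1..n. l j) = t n - t 0"
        unfolding l_def using sum_telescope''[of 0 n t] by simp
      then show "(\<Sum>j=1..n. l j) \<le> 1" using P by (simp add: unit_partition_def)
      have "(\<Sum>k<M. (1 + real k) powr (-q) * 2^k * (\<Sum>j=1..n. T j k)) \<le> (\<Sum>k<M. (1 + real k) powr (-q) * (4 * A))"
      proof (rule sum_mono)
        fix k
        have d: "0 \<le> d k" "d k \<le> 2" by (auto simp: d_def field_simps)
        have "(\<Sum>j=1..n. T j k) \<le> 2 * d k * A"
          unfolding T_def l_def A_def by (rule shifted_increments[OF u d P])
        then have "2^k * (\<Sum>j=1..n. T j k) \<le> 2^k * (2 * d k * A)" by (intro mult_left_mono) auto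
        also have "\<dots> = 4 * A" by (simp add: d_def)
        finally show "(1 + real k) powr (-q) * 2^k * (\<Sum>j=1..n. T j k) \<le> (1 + real k) powr (-q) * (4 * A)"
          unfolding mult.assoc by (intro mult_left_mono) auto
      qed
      also have "\<dots> = 4 * A * (\<Sum>k<M. (1 + real k) powr (-q))" by (simp add: sum_distrib_left mult_ac)
      also have "\<dots> \<le> 4 * A * S" using A by (intro mult_left_mono S) auto
      finally show "(\<Sum>k<M. (1 + real k) powr (-q) * 2^k * (\<Sum>j=1..n. T j k)) \<le> 4 * A * S" .
    qed (use B0 H in auto)
    finally show "(\<Sum>j=1..n. log_gauge q (cmod (Complex (u (t j)) (v (t j)) - Complex (u (t (j-1))) (v (t (j-1)))))) \<le>
       c powr (-q) * (A + B * 1 + H * (4 * A * S))" by (simp add: G_def)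
  qed
qed

section \<open>Area of injective images\<close>

text \<open>Identifying the two models of the plane makes it possible to combine the Jacobian formula on \<open>real^2\<close> with
iterated integrals on \<open>real \<times> real\<close>.\<close>

lemma lborel_real2: "lborel = distr (lborel :: (real^2) measure) borel (\<lambda>x. (x$1, x$2))"
proof (rule lborel_eqI)
  fix l u :: "real \<times> real"
  assume lu: "\<And>b. b \<in> Basis \<Longrightarrow> l \<bullet> b \<le> u \<bullet> b"
  have le: "fst l \<le> fst u" "snd l \<le> snd u"
    using lu[of "(1,0)"] lu[of "(0,1)"] by (auto simp: Basis_prod_def inner_prod_def)
  have m: "(\<lambda>x::real^2. (x$1, x$2)) \<in> borel_measurable lborel"
    by measurable
  have pre: "(\<lambda>x::real^2. (x$1, x$2)) -` box l u = box (vector [fst l, snd l]) (vector [fst u, snd u])"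
    by (auto simp: mem_box_cart box_prod mem_box Basis_prod_def inner_prod_def forall_2)
  have bas: "(Basis :: (real^2) set) = {axis 1 1, axis 2 1}"
    by (auto simp: Basis_vec_def UNIV_2)
  have ne: "axis 1 1 \<noteq> (axis 2 1 :: real^2)"
    by (simp add: axis_eq_axis)
  have "emeasure lborel (box (vector [fst l, snd l]) (vector [fst u, snd u]) :: (real^2) set)
     = (fst u - fst l) * (snd u - snd l)"
    using le ne by (subst emeasure_lborel_box) (auto simp: bas inner_axis)
  moreover have "(\<Prod>b\<in>Basis. (u - l) \<bullet> b) = (fst u - fst l) * (snd u - snd l)"
    by (simp add: Basis_prod_def inner_prod_def)
  ultimately show "emeasure (distr (lborel :: (real^2) measure) borel (\<lambda>x. (x$1, x$2))) (box l u) =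
      (\<Prod>b\<in>Basis. (u - l) \<bullet> b)"
    using m by (subst emeasure_distr) (auto simp: pre)
qed simp

text \<open>The integral of the Jacobian of an injective map is the area of its image, hence at most the area of a
rectangle that contains the image. The partial derivatives are \<open>Gs\<close> and \<open>Gt\<close>; the Jacobian is
\<open>Im (cnj Gs * Gt)\<close>, the determinant of these two vectors.\<close>

lemma nn_integral_Jacobian_le_area:
  fixes G Gs Gt :: "real \<times> real \<Rightarrow> complex" and J :: "real \<times> real \<Rightarrow> real"
  assumes A: "A \<in> sets borel" "bounded A"
    and der: "\<And>p. p \<in> A \<Longrightarrow> (G has_derivative (\<lambda>v. fst v *\<^sub>R Gs p + snd v *\<^sub>R Gt p)) (at p within A)"
    and inj: "inj_on G A"
    and J: "J \<in> borel_measurable borel" "\<And>p. p \<in> A \<Longrightarrow> J p = \<bar>Im (cnj (Gs p) * Gt p)\<bar>"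
    and bd: "\<And>p. p \<in> A \<Longrightarrow> J p \<le> B"
    and img: "G ` A \<subseteq> cbox (Complex a c) (Complex b d)" and le: "a \<le> b" "c \<le> d"
  shows "(\<integral>\<^sup>+p. ennreal (J p) * indicator A p \<partial>lborel) \<le> ennreal ((b - a) * (d - c))"
proof -
  define e :: "real^2 \<Rightarrow> real \<times> real" where "e = (\<lambda>x. (x$1, x$2))"
  define V :: "complex \<Rightarrow> real^2" where "V = (\<lambda>z. vector [Re z, Im z])"
  define F where "F = (\<lambda>x. V (G (e x)))"
  define F' :: "real^2 \<Rightarrow> real^2 \<Rightarrow> real^2" where "F' = (\<lambda>x v. V (v$1 *\<^sub>R Gs (e x) + v$2 *\<^sub>R Gt (e x)))"
  define S where "S = e -` A"
  have em: "e \<in> borel_measurable borel" unfolding e_def by measurable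
  have S: "S \<in> sets borel"
    using measurable_sets[OF em A(1)] by (simp add: S_def)
  have injV: "inj V" by (auto simp: V_def inj_def vec_eq_iff forall_2 complex_eq_iff)
  have "linear V" by (intro linearI) (auto simp: V_def vec_eq_iff forall_2)
  then have blV: "bounded_linear V" by (rule linear_conv_bounded_linear[THEN iffD1])
  have ble: "bounded_linear e"
    unfolding e_def by (intro bounded_linear_Pair bounded_linear_vec_nth)
  obtain C where C: "\<And>p. p \<in> A \<Longrightarrow> norm p \<le> C" using A(2) by (auto simp: bounded_iff)
  have bS: "bounded S"
  proof (rule boundedI)
    fix x assume "x \<in> S"
    then have "norm (e x) \<le> C" using C by (simp add: S_def)
    then have "\<bar>x$1\<bar> \<le> C \<and> \<bar>x$2\<bar> \<le> C"
      using norm_fst_le[of "x$1" "x$2"] norm_snd_le[of "x$2" "x$1"] by (simp add: e_def)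
    then show "norm x \<le> C + C" using norm_le_l1_cart[of x] by (simp add: sum_2)
  qed
  have Sl: "S \<in> sets lebesgue" using S by auto
  have Sm: "S \<in> lmeasurable" using bS Sl by (simp add: bounded_set_imp_lmeasurable)
  have derF: "(F has_derivative F' x) (at x within S)" if "x \<in> S" for x
  proof -
    have "(e has_derivative e) (at x within S)" using ble by (rule bounded_linear_imp_has_derivative)
    moreover have "(G has_derivative (\<lambda>v. fst v *\<^sub>R Gs (e x) + snd v *\<^sub>R Gt (e x))) (at (e x) within e ` S)"
      by (rule has_derivative_subset[OF der]) (use that in \<open>auto simp: S_def\<close>)
    ultimately have "((\<lambda>x. G (e x)) has_derivative (\<lambda>v. fst (e v) *\<^sub>R Gs (e x) + snd (e v) *\<^sub>R Gt (e x))) (at x within S)"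
      by (rule has_derivative_in_compose)
    from bounded_linear.has_derivative[OF blV this] show ?thesis
      by (simp add: F_def F'_def e_def)
  qed
  have det: "\<bar>det (matrix (F' x))\<bar> = J (e x)" if "x \<in> S" for x
    using that by (simp add: det_2 matrix_def F'_def V_def axis_def J(2) S_def mult.commute)
  have injF: "inj_on F S"
    using inj injV by (auto simp: inj_on_def F_def S_def inj_def e_def vec_eq_iff forall_2)
  have Jm: "(\<lambda>x. J (e x)) \<in> borel_measurable lborel"
    using measurable_compose[OF em J(1)] by simp
  have J0: "J p \<ge> 0" if "p \<in> A" for p using J(2)[OF that] by simp
  have int: "(\<lambda>x. \<bar>det (matrix (F' x))\<bar>) integrable_on S"
  proof -
    have "(\<lambda>x. J (e x)) \<in> borel_measurable (lebesgue_on S)"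
      using Jm by (intro measurable_restrict_space1 measurable_completion) simp
    then have "(\<lambda>x. J (e x)) integrable_on S"
    proof (rule measurable_bounded_by_integrable_imp_integrable_real[where g="\<lambda>_. \<bar>B\<bar>"])
      show "(\<lambda>_. \<bar>B\<bar>) integrable_on S" using Sm by (simp add: integrable_on_const)
      show "\<bar>J (e x)\<bar> \<le> \<bar>B\<bar>" if "x \<in> S" for x
        using J0[of "e x"] bd[of "e x"] that by (simp add: S_def)
    qed (rule Sl)
    then show ?thesis using det by (simp cong: integrable_cong)
  qed
  have "measure lebesgue (F ` S) = integral S (\<lambda>x. J (e x))"
    using measure_differentiable_image_eq[OF Sl derF injF int] det by (simp cong: integral_cong)
  moreover have "F ` S \<in> lmeasurable"
    using measurable_differentiable_image_eq[OF Sl derF injF] int by simp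
  moreover have "F ` S \<subseteq> cbox (vector [a, c]) (vector [b, d])"
    using img by (auto simp: F_def S_def V_def mem_box_cart forall_2 in_cbox_complex_iff)
  ultimately have "integral S (\<lambda>x. J (e x)) \<le> measure lebesgue (cbox (vector [a, c]) (vector [b, d]) :: (real^2) set)"
    by (metis measure_mono_fmeasurable fmeasurableD lmeasurable_cbox)
  also have "\<dots> = (b - a) * (d - c)"
  proof -
    have "cbox (vector [a, c]) (vector [b, d] :: real^2) \<noteq> {}"
      using le by (auto simp: interval_ne_empty_cart forall_2)
    then show ?thesis using le by (simp add: measure_completion content_cbox_cart UNIV_2)
  qed
  finally have int_le: "integral S (\<lambda>x. J (e x)) \<le> (b - a) * (d - c)" .
  have "(\<lambda>x. J (e x)) integrable_on S" using int det by (simp cong: integrable_cong)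
  then have "((\<lambda>x. J (e x)) has_integral integral S (\<lambda>x. J (e x))) S" by (rule integrable_integral)
  then have "(\<integral>\<^sup>+x. ennreal (J (e x)) * indicator S x \<partial>lborel) = ennreal (integral S (\<lambda>x. J (e x)))"
    using J0 by (intro nn_integral_has_integral_lebesgue') (auto simp: S_def)
  moreover have "(\<integral>\<^sup>+p. ennreal (J p) * indicator A p \<partial>lborel) = (\<integral>\<^sup>+x. ennreal (J (e x)) * indicator S x \<partial>lborel)"
    unfolding lborel_real2 using A(1) J(1) em
    unfolding e_def[symmetric] by (subst nn_integral_distr) (auto simp: S_def indicator_def intro!: nn_integral_cong)
  ultimately show ?thesis using int_le by (simp add: ennreal_leI)
qed

section \<open>Quasisymmetry of smooth quasiconformal maps\<close>

text \<open>The image of the open disc is open by invariance of domain, so \<open>cmod (g z - q)\<close> cannot have its maximum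
over the closed disc inside, unless it vanishes identically.\<close>

lemma max_modulus_on_sphere:
  fixes g :: "complex \<Rightarrow> complex"
  assumes g: "continuous_on UNIV g" "inj g" and R: "R > 0"
  shows "\<exists>z\<in>sphere p R. cmod (g p - q) \<le> cmod (g z - q)"
proof -
  have "\<exists>z\<in>cball p R. \<forall>y\<in>cball p R. cmod (g y - q) \<le> cmod (g z - q)"
    using R by (intro continuous_attains_sup continuous_intros continuous_on_subset[OF g(1)]) auto
  then obtain z where z: "z \<in> cball p R" "\<And>y. y \<in> cball p R \<Longrightarrow> cmod (g y - q) \<le> cmod (g z - q)" by blast
  have pz: "cmod (g p - q) \<le> cmod (g z - q)" using z R by simp
  show ?thesis
  proof (cases "z \<in> sphere p R \<or> g z = q")
    case True
    have "p + of_real R \<in> sphere p R" using R by (simp add: dist_norm)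
    then show ?thesis using True pz by (cases "z \<in> sphere p R") auto
  next
    case False
    then have zb: "z \<in> ball p R" and ne: "g z \<noteq> q" using z by (auto simp: less_le)
    have "open (g ` ball p R)"
      using g by (intro invariance_of_domain) (auto intro: continuous_on_subset inj_on_subset)
    then obtain e where e: "e > 0" "ball (g z) e \<subseteq> g ` ball p R"
      using zb by (meson image_eqI open_contains_ball)
    define r where "r = e / (2 * cmod (g z - q))"
    have r: "r > 0" using e ne by (simp add: r_def)
    define w where "w = g z + of_real r * (g z - q)"
    have "cmod (w - g z) = r * cmod (g z - q)" using r by (simp add: w_def norm_mult)
    also have "\<dots> < e" using e ne by (simp add: r_def)
    finally have "w \<in> ball (g z) e" by (simp add: dist_norm norm_minus_commute)
    then obtain y where y: "y \<in> ball p R" "w = g y" using e by auto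
    have "w - q = of_real (1 + r) * (g z - q)" by (simp add: w_def algebra_simps)
    then have "cmod (w - q) = (1 + r) * cmod (g z - q)" using r by (simp add: norm_mult del: of_real_add)
    also have "\<dots> > 1 * cmod (g z - q)" using r ne by (intro mult_strict_right_mono) auto
    finally show ?thesis using z(2)[of y] y by simp
  qed
qed

text \<open>If the image of the circle missed the closed disc about \<open>g c\<close> through \<open>g x\<close>, this connected set would
lie in the image of the open disc \<open>ball p R\<close>, which it meets in \<open>g c\<close>; then \<open>x\<close> would lie in \<open>ball p R\<close>.\<close>

lemma min_modulus_on_sphere:
  fixes g :: "complex \<Rightarrow> complex"
  assumes g: "continuous_on UNIV g" "inj g" and c: "c \<in> ball p R" and x: "x \<notin> ball p R"
  shows "\<exists>z\<in>sphere p R. cmod (g z - g c) \<le> cmod (g x - g c)"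
proof (rule ccontr)
  assume "\<not> ?thesis"
  then have far: "cmod (g z - g c) > cmod (g x - g c)" if "z \<in> sphere p R" for z
    using that by (meson not_le)
  let ?A = "cball (g c) (cmod (g x - g c))" and ?U = "g ` ball p R" and ?V = "- g ` cball p R"
  have "open ?U"
    using g by (intro invariance_of_domain) (auto intro: continuous_on_subset inj_on_subset)
  moreover have "open ?V"
    using g by (intro open_Compl compact_imp_closed compact_continuous_image) (auto intro: continuous_on_subset)
  moreover have "?A \<subseteq> ?U \<union> ?V"
  proof
    fix w assume w: "w \<in> ?A"
    show "w \<in> ?U \<union> ?V"
    proof (cases "w \<in> g ` cball p R")
      case True
      then obtain z where z: "z \<in> cball p R" "w = g z" by auto
      then have "z \<notin> sphere p R" using far[of z] w by (auto simp: dist_norm norm_minus_commute)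
      then show ?thesis using z by (auto simp: less_le)
    qed auto
  qed
  moreover have "?U \<inter> ?V \<inter> ?A = {}" by auto
  ultimately have "?U \<inter> ?A = {} \<or> ?V \<inter> ?A = {}"
    by (intro connectedD[OF convex_connected[OF convex_cball]])
  moreover have "g c \<in> ?U \<inter> ?A" using c by simp
  moreover have "g x \<in> ?A" by (simp add: dist_norm norm_minus_commute)
  ultimately have "g x \<in> g ` cball p R" by auto
  then have "x \<in> cball p R" using g(2) by (metis image_iff injD)
  then have "x \<in> sphere p R" using x by auto
  then show False using far by blast
qed

lemma crossing_subinterval:
  fixes f :: "real \<Rightarrow> real"
  assumes f: "continuous_on UNIV f" and xy: "x \<le> y" "f x \<le> e" "M \<le> f y" "e \<le> M"
  obtains a b where "x \<le> a" "a \<le> b" "b \<le> y" "f a = e" "f b = M" "\<And>t. t \<in> {a..b} \<Longrightarrow> e \<le> f t \<and> f t \<le> M"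
proof -
  have ivt: "\<exists>t\<ge>r. t \<le> r' \<and> f t = m" if "r \<le> r'" "f r \<le> m" "m \<le> f r'" for r r' m
    using that f by (intro IVT') (auto intro: continuous_on_subset)
  \<comment> \<open>\<open>b\<close> is the first time at which \<open>f\<close> reaches \<open>M\<close>, \<open>a\<close> the last time before \<open>b\<close> at which it is at most \<open>e\<close>\<close>
  define S where "S = {x..y} \<inter> f -` {M..}"
  have clo: "closed (f -` B)" if "closed B" for B using f that by (simp add: continuous_on_closed_vimage)
  have "compact S" unfolding S_def by (intro compact_Int_closed clo) auto
  moreover have "y \<in> S" using xy by (simp add: S_def)
  ultimately obtain b where b: "b \<in> S" "\<And>t. t \<in> S \<Longrightarrow> b \<le> t" using compact_attains_inf[of S] by blast
  obtain b' where b': "x \<le> b'" "b' \<le> b" "f b' = M" using ivt[of x b M] b xy by (auto simp: S_def)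
  have "b' \<in> S" using b' b by (auto simp: S_def)
  then have fb: "f b = M" using b(2)[of b'] b' by simp
  have ltM: "f t < M" if "x \<le> t" "t < b" for t
    using b(2)[of t] that b(1) by (force simp: S_def not_le[symmetric])
  define T where "T = {x..b} \<inter> f -` {..e}"
  have "compact T" unfolding T_def by (intro compact_Int_closed clo) auto
  moreover have "x \<in> T" using xy b by (simp add: T_def S_def)
  ultimately obtain a where a: "a \<in> T" "\<And>t. t \<in> T \<Longrightarrow> t \<le> a" using compact_attains_sup[of T] by blast
  obtain a' where a': "a \<le> a'" "a' \<le> b" "f a' = e" using ivt[of a b e] a xy fb by (auto simp: T_def)
  have "a' \<in> T" using a' a by (auto simp: T_def)
  then have fa: "f a = e" using a(2)[of a'] a' by simp
  have gte: "e < f t" if "a < t" "t \<le> b" for t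
    using a(2)[of t] that a(1) by (force simp: T_def not_le[symmetric])
  show ?thesis
  proof (rule that[of a b])
    show "e \<le> f t \<and> f t \<le> M" if "t \<in> {a..b}" for t
      using that ltM[of t] gte[of t] fa fb a(1) by (cases "t = a"; cases "t = b") (auto simp: T_def)
  qed (use a b fa fb in \<open>auto simp: T_def S_def\<close>)
qed

text \<open>The length of a curve in the metric \<open>\<bar>dw\<bar> / \<bar>w\<bar>\<close> bounds the change of \<open>ln \<bar>w\<bar>\<close> along it.\<close>

lemma log_length_on_interval:
  fixes h h' :: "real \<Rightarrow> complex"
  assumes h: "\<And>t. (h has_vector_derivative h' t) (at t)" and h': "continuous_on UNIV h'"
    and ab: "a \<le> b" and pos: "\<And>t. t \<in> {a..b} \<Longrightarrow> h t \<noteq> 0"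
  shows "\<bar>ln (cmod (h b)) - ln (cmod (h a))\<bar> \<le> integral {a..b} (\<lambda>t. cmod (h' t) / cmod (h t))"
    and "(\<lambda>t. cmod (h' t) / cmod (h t)) integrable_on {a..b}"
proof -
  define F' where "F' t = inner (h' t) (sgn (h t)) / cmod (h t)" for t
  have F: "((\<lambda>t. ln (cmod (h t))) has_vector_derivative F' t) (at t within {a..b})" if "t \<in> {a..b}" for t
  proof -
    have "(norm has_derivative (\<lambda>v. inner v (sgn (h t)))) (at (h t))"
      using pos[OF that] by (intro has_derivative_norm) auto
    from has_derivative_compose[OF h[unfolded has_vector_derivative_def] this]
    have "((\<lambda>t. cmod (h t)) has_real_derivative inner (h' t) (sgn (h t))) (at t)"
      by (simp add: has_field_derivative_def mult_commute_abs)
    then have "((\<lambda>t. ln (cmod (h t))) has_real_derivative F' t) (at t)"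
      unfolding F'_def using pos[OF that] by (auto intro!: derivative_eq_intros)
    then show ?thesis
      by (simp add: has_real_derivative_iff_has_vector_derivative[symmetric] has_field_derivative_at_within)
  qed
  have I: "(F' has_integral ln (cmod (h b)) - ln (cmod (h a))) {a..b}"
    using fundamental_theorem_of_calculus[OF ab F] by simp
  have ch: "continuous_on UNIV h"
    by (intro continuous_at_imp_continuous_on ballI has_vector_derivative_continuous[OF h])
  show int: "(\<lambda>t. cmod (h' t) / cmod (h t)) integrable_on {a..b}"
    using pos by (intro integrable_continuous_interval continuous_intros continuous_on_subset[OF ch] continuous_on_subset[OF h']) auto
  have "norm (integral {a..b} F') \<le> integral {a..b} (\<lambda>t. cmod (h' t) / cmod (h t))"
  proof (rule integral_norm_bound_integral)
    show "norm (F' t) \<le> cmod (h' t) / cmod (h t)" if "t \<in> {a..b}" for t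
    proof -
      have "\<bar>inner (h' t) (sgn (h t))\<bar> \<le> cmod (h' t) * norm (sgn (h t))" by (rule Cauchy_Schwarz_ineq2)
      then show ?thesis using pos[OF that] by (simp add: F'_def norm_sgn divide_right_mono)
    qed
  qed (use I int in auto)
  then show "\<bar>ln (cmod (h b)) - ln (cmod (h a))\<bar> \<le> integral {a..b} (\<lambda>t. cmod (h' t) / cmod (h t))"
    using I by (simp add: integral_unique)
qed

text \<open>A curve that meets both the disc \<open>\<bar>w\<bar> \<le> e\<close> and the set \<open>\<bar>w\<bar> \<ge> M\<close> crosses the annulus in between, and
already the part of it inside the annulus has length at least \<open>ln (M / e)\<close> in the metric
\<open>\<bar>dw\<bar> / \<bar>w\<bar>\<close>.\<close>

lemma log_length_crossing:
  fixes h h' :: "real \<Rightarrow> complex"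
  assumes h: "\<And>t. (h has_vector_derivative h' t) (at t)" and h': "continuous_on UNIV h'"
    and e: "0 < e" "e \<le> M" and x: "x \<in> {0..c}" "cmod (h x) \<le> e" and y: "y \<in> {0..c}" "M \<le> cmod (h y)"
  shows "ennreal (ln (M / e)) \<le> (\<integral>\<^sup>+t. ennreal (cmod (h' t) / cmod (h t)) * indicator {t. 0 \<le> t \<and> t \<le> c \<and> e \<le> cmod (h t) \<and> cmod (h t) \<le> M} t \<partial>lborel)"
proof -
  have "continuous_on UNIV h"
    by (intro continuous_at_imp_continuous_on ballI has_vector_derivative_continuous[OF h])
  then have c: "continuous_on UNIV (\<lambda>t. cmod (h t))" by (intro continuous_intros)
  have c': "continuous_on UNIV (\<lambda>t. cmod (h (-t)))"
    by (rule continuous_on_compose2[OF c]) (auto intro: continuous_intros)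
  have "\<exists>a b. 0 \<le> a \<and> a \<le> b \<and> b \<le> c \<and> \<bar>ln (cmod (h b)) - ln (cmod (h a))\<bar> = ln (M / e)
      \<and> (\<forall>t\<in>{a..b}. e \<le> cmod (h t) \<and> cmod (h t) \<le> M)"
  \<comment> \<open>if the curve runs from the outside to the inside, time is reversed\<close>
  proof (cases "x \<le> y")
    case True
    obtain a b where *: "x \<le> a" "a \<le> b" "b \<le> y" "cmod (h a) = e" "cmod (h b) = M"
      "\<And>t. t \<in> {a..b} \<Longrightarrow> e \<le> cmod (h t) \<and> cmod (h t) \<le> M"
      using crossing_subinterval[OF c True x(2) y(2) e(2)] by blast
    show ?thesis using * e x y by (intro exI[of _ a] exI[of _ b]) (auto simp: ln_div)
  next
    case False
    have "- x \<le> - y" "cmod (h (- (- x))) \<le> e" "M \<le> cmod (h (- (- y)))" using False x y by auto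
    from crossing_subinterval[OF c' this e(2)]
    obtain a b where *: "- x \<le> a" "a \<le> b" "b \<le> - y" "cmod (h (-a)) = e" "cmod (h (-b)) = M"
      "\<And>t. t \<in> {a..b} \<Longrightarrow> e \<le> cmod (h (-t)) \<and> cmod (h (-t)) \<le> M"
      by blast
    have "e \<le> cmod (h t) \<and> cmod (h t) \<le> M" if "t \<in> {-b..-a}" for t using *(6)[of "-t"] that by auto
    then show ?thesis using * e x y by (intro exI[of _ "-b"] exI[of _ "-a"]) (auto simp: ln_div)
  qed
  then obtain a b where ab: "0 \<le> a" "a \<le> b" "b \<le> c" "\<bar>ln (cmod (h b)) - ln (cmod (h a))\<bar> = ln (M / e)"
      "\<And>t. t\<in>{a..b} \<Longrightarrow> e \<le> cmod (h t) \<and> cmod (h t) \<le> M" by blast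
  have "h t \<noteq> 0" if "t \<in> {a..b}" for t using ab(5)[OF that] e by auto
  note L = log_length_on_interval[OF h h' ab(2) this]
  have "ennreal (ln (M / e)) \<le> ennreal (integral {a..b} (\<lambda>t. cmod (h' t) / cmod (h t)))"
    using L(1) ab(4) by (intro ennreal_leI) simp
  also have "\<dots> = (\<integral>\<^sup>+t. ennreal (cmod (h' t) / cmod (h t)) * indicator {a..b} t \<partial>lborel)"
    using integrable_integral[OF L(2)] by (intro nn_integral_has_integral_lebesgue'[symmetric]) auto
  also have "\<dots> \<le> (\<integral>\<^sup>+t. ennreal (cmod (h' t) / cmod (h t)) * indicator {t. 0 \<le> t \<and> t \<le> c \<and> e \<le> cmod (h t) \<and> cmod (h t) \<le> M} t \<partial>lborel)"
    using ab by (intro nn_integral_mono mult_left_mono) (auto simp: indicator_def)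
  finally show ?thesis .
qed

text \<open>Write \<open>D\<close> for the real derivative and \<open>a\<close>, \<open>b\<close> for its complex linear and antilinear parts at \<open>w\<close>. The
determinant of \<open>D w\<close> and \<open>D (\<i> * w)\<close> is \<open>\<bar>a\<bar>\<^sup>2 - \<bar>b\<bar>\<^sup>2\<close>, while \<open>D (\<i> * w)\<close> has modulus at most
\<open>\<bar>a\<bar> + \<bar>b\<bar>\<close>.\<close>

lemma dilatation_inequality:
  fixes px py w :: complex
  assumes k: "0 \<le> k" "k < 1" and cone: "cmod (wirtinger_bar px py) \<le> k * cmod (wirtinger px py)"
  defines "D \<equiv> \<lambda>v. Re v *\<^sub>R px + Im v *\<^sub>R py"
  shows "(cmod (D (\<i> * w)))\<^sup>2 \<le> (1+k)/(1-k) * Im (cnj (D w) * D (\<i> * w))"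
    and "0 \<le> Im (cnj (D w) * D (\<i> * w))"
proof -
  define a where "a = wirtinger px py * w"
  define b where "b = wirtinger_bar px py * cnj w"
  have Dab: "D w = a + b" "D (\<i> * w) = \<i> * (a - b)"
    by (auto simp: D_def a_def b_def wirtinger_def wirtinger_bar_def complex_eq_iff field_simps)
  have ba: "cmod b \<le> k * cmod a"
    using mult_right_mono[OF cone, of "cmod w"] by (simp add: a_def b_def norm_mult mult_ac)
  have J: "Im (cnj (D w) * D (\<i> * w)) = (cmod a)\<^sup>2 - (cmod b)\<^sup>2"
    unfolding Dab cmod_power2 by (simp add: algebra_simps power2_eq_square)
  have "cmod b \<le> 1 * cmod a" using ba k by (meson mult_right_mono norm_ge_zero less_imp_le order_trans)
  then have ba1: "cmod b \<le> cmod a" by simp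
  show "0 \<le> Im (cnj (D w) * D (\<i> * w))" unfolding J using power_mono[OF ba1, of 2] by simp
  have "(1-k) * (cmod a + cmod b) \<le> (1+k) * (cmod a - cmod b)" using ba by (simp add: algebra_simps)
  then have *: "cmod a + cmod b \<le> (1+k)/(1-k) * (cmod a - cmod b)" using k by (simp add: field_simps)
  have "(cmod (D (\<i> * w)))\<^sup>2 \<le> (cmod a + cmod b)\<^sup>2"
    unfolding Dab by (intro power_mono) (auto simp: norm_mult norm_triangle_ineq4)
  also have "\<dots> = (cmod a + cmod b) * (cmod a + cmod b)" by (simp add: power2_eq_square)
  also have "\<dots> \<le> ((1+k)/(1-k) * (cmod a - cmod b)) * (cmod a + cmod b)"
    using * by (intro mult_right_mono) auto
  also have "\<dots> = (1+k)/(1-k) * Im (cnj (D w) * D (\<i> * w))"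
    unfolding J by (simp only: power2_eq_square square_diff_square_factored mult_ac)
  finally show "(cmod (D (\<i> * w)))\<^sup>2 \<le> (1+k)/(1-k) * Im (cnj (D w) * D (\<i> * w))" .
qed

text \<open>This is the length-area method. Let \<open>p = c - h\<close>, \<open>e = \<bar>g (c + h) - g c\<bar>\<close> and \<open>M = \<bar>g (c - h) - g c\<bar>\<close>. A
circle about \<open>p\<close> of radius \<open>r\<close> times \<open>\<bar>h\<bar>\<close> with \<open>1 < r < 2\<close> separates \<open>p\<close> and \<open>c\<close> from \<open>c + h\<close>, so on it
\<open>\<bar>g - g c\<bar>\<close> takes a value at most \<open>e\<close> and a value at least \<open>M\<close>. The image of the circle therefore crosses
the annulus \<open>e \<le> \<bar>w\<bar> \<le> M\<close> and has there a logarithmic length of at least \<open>L = ln (M / e)\<close>. By the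
Cauchy-Schwarz inequality and the bound on the dilatation, the logarithmic area of the image, integrated
over the circles, is at least a constant times \<open>L\<^sup>2\<close>. Since \<open>g\<close> is injective this area is at most a
constant times \<open>L\<close>, and \<open>L\<close> is bounded.\<close>

lemma weak_quasisymmetry:
  fixes g gx gy :: "complex \<Rightarrow> complex"
  assumes der: "\<And>z. (g has_derivative (\<lambda>v. Re v *\<^sub>R gx z + Im v *\<^sub>R gy z)) (at z)"
    and cont: "continuous_on UNIV gx" "continuous_on UNIV gy"
    and inj: "inj g" and k: "0 \<le> k" "k < 1"
    and cone: "\<And>z. cmod (wirtinger_bar (gx z) (gy z)) \<le> k * cmod (wirtinger (gx z) (gy z))"
  shows "cmod (g (c - h) - g c) \<le> exp (8 * pi\<^sup>2 * ((1+k)/(1-k)) / ln 2) * cmod (g (c + h) - g c)"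
proof -
  define K where "K = (1+k)/(1-k)"
  have K: "K \<ge> 1" using k by (simp add: K_def field_simps)
  define e where "e = cmod (g (c + h) - g c)"
  define M where "M = cmod (g (c - h) - g c)"
  have cg: "continuous_on UNIV g"
    by (intro continuous_at_imp_continuous_on ballI has_derivative_continuous[OF der])
  show ?thesis
  proof (cases "h = 0 \<or> M \<le> e")
    case True
    have "1 * e \<le> exp (8 * pi\<^sup>2 * ((1+k)/(1-k)) / ln 2) * e"
      using k by (intro mult_right_mono) (auto simp: e_def)
    then show ?thesis using True by (auto simp: e_def M_def)
  next
    case False
    then have h: "h \<noteq> 0" and eM: "e < M" by auto
    have e: "e > 0" using h injD[OF inj, of "c + h" c] by (auto simp: e_def)
    define L where "L = ln (M / e)"
    have L: "L > 0" using e eM by (simp add: L_def)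
    define p where "p = c - h"
    \<comment> \<open>logarithmic polar coordinates about \<open>p\<close>: the first coordinate is the logarithm of the radius, the second the angle\<close>
    define ph where "ph = (\<lambda>x::real\<times>real. h * exp (Complex (fst x) (snd x)))"
    define D where "D = (\<lambda>x v. Re v *\<^sub>R gx (p + ph x) + Im v *\<^sub>R gy (p + ph x))"
    define F where "F = (\<lambda>x. g (p + ph x) - g c)"
    define Fs where "Fs = (\<lambda>x. D x (ph x))"
    define Ft where "Ft = (\<lambda>x. D x (\<i> * ph x))"
    define J where "J = (\<lambda>x. Im (cnj (Fs x) * Ft x))"
    have cph: "continuous_on S ph" for S unfolding ph_def Complex_eq by (intro continuous_intros)
    have comp: "continuous_on S (\<lambda>x. f (p + ph x))" if "continuous_on UNIV f" for f :: "complex \<Rightarrow> complex" and S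
      by (rule continuous_on_compose2[OF that]) (auto intro!: continuous_intros cph)
    have cF: "continuous_on S F" and cFs: "continuous_on S Fs" and cFt: "continuous_on S Ft" and cJ: "continuous_on S J" for S
      unfolding J_def F_def Fs_def Ft_def D_def by (intro continuous_intros comp cont cg cph)+
    have mF[measurable]: "F \<in> borel_measurable borel" and mFt[measurable]: "Ft \<in> borel_measurable borel"
      and mJ[measurable]: "J \<in> borel_measurable borel"
      using cF cFt cJ by (auto intro: borel_measurable_continuous_onI)
    have mF2[measurable]: "F \<in> borel_measurable (borel \<Otimes>\<^sub>M borel)"
      and mFt2[measurable]: "Ft \<in> borel_measurable (borel \<Otimes>\<^sub>M borel)"
      and mJ2[measurable]: "J \<in> borel_measurable (borel \<Otimes>\<^sub>M borel)"
      using mF mFt mJ by (simp_all add: borel_prod)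
    have Jdil: "(cmod (Ft x))\<^sup>2 \<le> K * J x" and J0: "0 \<le> J x" for x
      using dilatation_inequality[OF k cone] by (auto simp: Ft_def Fs_def J_def D_def K_def)
    have derF: "(F has_derivative (\<lambda>v. fst v *\<^sub>R Fs x + snd v *\<^sub>R Ft x)) (at x)" for x
    proof -
      have "((\<lambda>x::real\<times>real. Complex (fst x) (snd x)) has_derivative (\<lambda>v. Complex (fst v) (snd v))) (at x)"
        unfolding Complex_eq by (auto intro!: derivative_eq_intros)
      then have "(ph has_derivative (\<lambda>v. h * (exp (Complex (fst x) (snd x)) * Complex (fst v) (snd v)))) (at x)"
        unfolding ph_def by (intro has_derivative_mult_right has_derivative_compose[OF _ DERIV_exp[THEN has_field_derivative_imp_has_derivative]])
      from has_derivative_add[OF has_derivative_const this, of p]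
      have "((\<lambda>x. p + ph x) has_derivative (\<lambda>v. Complex (fst v) (snd v) * ph x)) (at x)"
        by (rule has_derivative_eq_rhs) (simp add: ph_def mult_ac)
      from has_derivative_compose[OF this der]
      have "((\<lambda>x. g (p + ph x)) has_derivative (\<lambda>v. D x (Complex (fst v) (snd v) * ph x))) (at x)"
        by (simp add: D_def)
      moreover have "D x (Complex (fst v) (snd v) * ph x) = fst v *\<^sub>R Fs x + snd v *\<^sub>R Ft x" for v
        by (simp add: D_def Fs_def Ft_def algebra_simps)
      ultimately show ?thesis unfolding F_def by (auto intro!: derivative_eq_intros)
    qed
    \<comment> \<open>a half-open range of angles, on which these coordinates are injective\<close>
    define E where "E = {x\<in>space (borel \<Otimes>\<^sub>M borel). 0 < fst x \<and> fst x < ln 2 \<and> 0 \<le> snd x \<and> snd x < 2*pi \<and> e \<le> cmod (F x) \<and> cmod (F x) \<le> M}"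
    have E: "E \<in> sets borel" unfolding E_def borel_prod[symmetric] by measurable
    have injph: "inj_on F E"
    proof (rule inj_onI)
      fix x y assume xy: "x \<in> E" "y \<in> E" "F x = F y"
      then have "ph x = ph y" using injD[OF inj, of "p + ph x" "p + ph y"] by (simp add: F_def)
      then have "exp (Complex (fst x) (snd x)) = exp (Complex (fst y) (snd y))" using h by (simp add: ph_def)
      moreover have "\<bar>snd x - snd y\<bar> < 2 * pi" using xy by (auto simp: E_def)
      ultimately have "Complex (fst x) (snd x) = Complex (fst y) (snd y)"
        using exp_complex_eqI[of "Complex (fst x) (snd x)" "Complex (fst y) (snd y)"] by simp
      then show "x = y" by (simp add: prod_eq_iff)
    qed
    \<comment> \<open>A logarithm turns the metric \<open>\<bar>dw\<bar> / \<bar>w\<bar>\<close> into the Euclidean one, but has a branch cut; the punctured plane is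
      covered by four rotated right half-planes, on each of which the principal branch is injective and maps the part of the
      annulus into a rectangle with sides \<open>L\<close> and \<open>pi\<close>.\<close>
    have area1: "(\<integral>\<^sup>+x. ennreal (J x / (cmod (F x))\<^sup>2) * indicator {x\<in>E. 0 < Re (w * F x)} x \<partial>lborel) \<le> ennreal (pi * L)"
      if w: "w \<in> {1, -1, \<i>, -\<i>}" for w
    proof -
      let ?A = "{x\<in>E. 0 < Re (w * F x)}"
      have w1: "cmod w = 1" "w \<noteq> 0" using w by auto
      have A: "?A \<in> sets borel"
      proof -
        have "?A = E \<inter> {x\<in>space borel. 0 < Re (w * F x)}" by auto
        moreover have "{x\<in>space borel. 0 < Re (w * F x)} \<in> sets borel" by measurable
        ultimately show ?thesis using E by auto
      qed
      have sub: "?A \<subseteq> cbox (0,0) (ln 2, 2*pi)" by (auto simp: E_def cbox_Pair_eq)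
      have F0: "F x \<noteq> 0" "e \<le> cmod (F x)" "cmod (F x) \<le> M" if "x \<in> E" for x using that e by (auto simp: E_def)
      obtain B where B: "\<And>x. x \<in> cbox (0,0) (ln 2, 2*pi) \<Longrightarrow> norm (J x) \<le> B"
        using compact_imp_bounded[OF compact_continuous_image[OF cJ compact_cbox]]
        by (metis bounded_iff image_eqI)
      show ?thesis
      proof (rule order_trans[OF nn_integral_Jacobian_le_area[where A="?A" and J="\<lambda>x. J x / (cmod (F x))\<^sup>2" and G="\<lambda>x. Ln (w * F x)" and Gs="\<lambda>x. Fs x / F x" and Gt="\<lambda>x. Ft x / F x"
             and B="B / e\<^sup>2" and a="ln e" and b="ln M" and c="-pi/2" and d="pi/2"]])
        show "bounded ?A" by (rule bounded_subset[OF bounded_cbox sub])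
        show "((\<lambda>x. Ln (w * F x)) has_derivative (\<lambda>v. fst v *\<^sub>R (Fs x / F x) + snd v *\<^sub>R (Ft x / F x))) (at x within ?A)"
          if x: "x \<in> ?A" for x
        proof -
          have nn: "w * F x \<notin> \<real>\<^sub>\<le>\<^sub>0" using x by (auto simp: complex_nonpos_Reals_iff)
          have "((\<lambda>x. w * F x) has_derivative (\<lambda>v. w * (fst v *\<^sub>R Fs x + snd v *\<^sub>R Ft x))) (at x within ?A)"
            by (intro has_derivative_mult_right has_derivative_at_withinI[OF derF])
          from has_derivative_compose[OF this has_field_derivative_imp_has_derivative[OF has_field_derivative_Ln[OF nn]]]
          show ?thesis
            by (rule has_derivative_eq_rhs) (use F0[of x] x w1 in \<open>auto simp: fun_eq_iff field_simps scaleR_conv_of_real\<close>)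
        qed
        show "inj_on (\<lambda>x. Ln (w * F x)) ?A"
        proof (rule inj_onI)
          fix x y assume xy: "x \<in> ?A" "y \<in> ?A" "Ln (w * F x) = Ln (w * F y)"
          then have "w * F x = w * F y" using F0 w1 by (metis (mono_tags, lifting) exp_Ln mem_Collect_eq mult_eq_0_iff)
          then have "F x = F y" using w1 by simp
          then show "x = y" using injph xy by (auto simp: inj_on_def)
        qed
        show "(\<lambda>x. J x / (cmod (F x))\<^sup>2) \<in> borel_measurable borel" by measurable
        show "J x / (cmod (F x))\<^sup>2 = \<bar>Im (cnj (Fs x / F x) * (Ft x / F x))\<bar>" if "x \<in> ?A" for x
        proof -
          have "cnj (Fs x / F x) * (Ft x / F x) = (cnj (Fs x) * Ft x) / complex_of_real ((cmod (F x))\<^sup>2)"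
            by (simp add: complex_norm_square mult_ac del: of_real_power)
          then have "Im (cnj (Fs x / F x) * (Ft x / F x)) = J x / (cmod (F x))\<^sup>2"
            by (simp only: J_def Im_divide_of_real)
          then show ?thesis using J0[of x] by simp
        qed
        show "J x / (cmod (F x))\<^sup>2 \<le> B / e\<^sup>2" if "x \<in> ?A" for x
        proof (rule frac_le)
          show "J x \<le> B" using B[of x] sub that by (auto simp: abs_le_iff)
          show "e\<^sup>2 \<le> (cmod (F x))\<^sup>2" using F0[of x] that e by (intro power_mono) auto
          show "0 \<le> B" using B[of "(0,0)"] by (auto simp: cbox_Pair_eq) 
        qed (use e in auto)
        show "(\<lambda>x. Ln (w * F x)) ` ?A \<subseteq> cbox (Complex (ln e) (-pi/2)) (Complex (ln M) (pi/2))"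
        proof (rule image_subsetI)
          fix x assume "x \<in> ?A"
          then have st: "x \<in> E" "0 < Re (w * F x)" by auto
          let ?x = x
          have ne: "w * F ?x \<noteq> 0" using F0[OF st(1)] w1 by simp
          have "\<bar>Im (Ln (w * F ?x))\<bar> < pi/2" using Re_Ln_pos_lt[OF ne] st by auto
          moreover have "Re (Ln (w * F ?x)) = ln (cmod (F ?x))" using ne w1 by (simp add: norm_mult)
          ultimately show "Ln (w * F ?x) \<in> cbox (Complex (ln e) (-pi/2)) (Complex (ln M) (pi/2))"
            using F0[OF st(1)] e by (auto simp: in_cbox_complex_iff)
        qed
        show "ennreal ((ln M - ln e) * (pi/2 - (-pi/2))) \<le> ennreal (pi * L)"
          using e eM by (intro ennreal_leI) (simp add: L_def ln_div algebra_simps)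
      qed (use A e eM in auto)
    qed
    define Q where "Q = (\<lambda>x. J x / (cmod (F x))\<^sup>2)"
    have Q0: "Q x \<ge> 0" for x using J0 by (simp add: Q_def)
    have mQ[measurable]: "Q \<in> borel_measurable borel" unfolding Q_def by measurable
    have mQ2[measurable]: "Q \<in> borel_measurable (borel \<Otimes>\<^sub>M borel)" using mQ by (simp add: borel_prod)
    have mE[measurable]: "E \<in> sets borel" by (rule E)
    have mE2[measurable]: "E \<in> sets (borel \<Otimes>\<^sub>M borel)" unfolding borel_prod by (rule E)
    have area: "(\<integral>\<^sup>+x. ennreal (Q x) * indicator E x \<partial>lborel) \<le> ennreal (4 * pi * L)"
    proof -
      let ?W = "{1, -1, \<i>, -\<i>}"
      have mW[measurable]: "{x\<in>E. 0 < Re (w * F x)} \<in> sets borel" for w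
      proof -
        have "{x\<in>E. 0 < Re (w * F x)} = E \<inter> {x\<in>space borel. 0 < Re (w * F x)}" by auto
        moreover have "{x\<in>space borel. 0 < Re (w * F x)} \<in> sets borel" by measurable
        ultimately show ?thesis using E by auto
      qed
      have "ennreal (Q x) * indicator E x \<le> (\<Sum>w\<in>?W. ennreal (Q x) * indicator {x\<in>E. 0 < Re (w * F x)} x)" for x
      proof (cases "x \<in> E")
        case True
        then have "F x \<noteq> 0" using e by (auto simp: E_def)
        then have "Re (F x) \<noteq> 0 \<or> Im (F x) \<noteq> 0" by (simp add: complex_eq_iff)
        then have "\<exists>w\<in>?W. 0 < Re (w * F x)" by simp linarith
        then obtain w where w: "w \<in> ?W" "0 < Re (w * F x)" by (rule bexE)
        have "ennreal (Q x) * indicator E x = ennreal (Q x) * indicator {x\<in>E. 0 < Re (w * F x)} x"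
          using True w by simp
        also have "\<dots> \<le> (\<Sum>w\<in>?W. ennreal (Q x) * indicator {x\<in>E. 0 < Re (w * F x)} x)"
          using w(1) by (intro member_le_sum) auto
        finally show ?thesis .
      qed simp
      then have "(\<integral>\<^sup>+x. ennreal (Q x) * indicator E x \<partial>lborel)
          \<le> (\<integral>\<^sup>+x. (\<Sum>w\<in>?W. ennreal (Q x) * indicator {x\<in>E. 0 < Re (w * F x)} x) \<partial>lborel)"
        by (intro nn_integral_mono)
      also have "\<dots> = (\<Sum>w\<in>?W. \<integral>\<^sup>+x. ennreal (Q x) * indicator {x\<in>E. 0 < Re (w * F x)} x \<partial>lborel)"
        by (rule nn_integral_sum) measurable
      also have "\<dots> \<le> (\<Sum>w\<in>?W. ennreal (pi * L))"
        using area1 by (intro sum_mono) (auto simp: Q_def)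
      also have "\<dots> = of_nat (card ?W) * ennreal (pi * L)" by simp
      also have "\<dots> \<le> 4 * ennreal (pi * L)"
      proof (rule mult_right_mono)
        have "card ?W \<le> 4" using card_length[of "[1, -1, \<i>, -\<i>]"] by simp
        then show "(of_nat (card ?W) :: ennreal) \<le> 4" using of_nat_mono[of "card ?W" 4] by simp
      qed simp
      also have "\<dots> = ennreal (4 * pi * L)" using L by (simp add: ennreal_mult' mult.assoc ennreal_numeral[symmetric] del: ennreal_numeral)
      finally show ?thesis .
    qed
    have length: "ennreal (L\<^sup>2) \<le> ennreal (2 * pi * K) * (\<integral>\<^sup>+t. ennreal (Q (s,t)) * indicator E (s,t) \<partial>lborel)"
      if s: "0 < s" "s < ln 2" for s
    proof -
      define R where "R = cmod h * exp s"
      have exps: "1 < exp s" "exp s < 2" using s by (auto simp: exp_less_cancel_iff[of s "ln 2", simplified])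
      then have R: "cmod h < R" "R < 2 * cmod h" using h by (auto simp: R_def)
      have polar: "\<exists>t\<in>{0..2*pi}. z = p + ph (s,t)" if z: "z \<in> sphere p R" for z
      proof -
        have "cmod ((z - p) / h) = exp s" using z h by (simp add: R_def dist_norm norm_divide norm_minus_commute)
        moreover define t where "t = Arg2pi ((z - p) / h)"
        have t: "0 \<le> t" "t < 2*pi" "(z - p) / h = of_real (cmod ((z - p) / h)) * exp (\<i> * of_real t)"
          using Arg2pi[of "(z - p) / h"] by (simp_all add: t_def is_Arg_def)
        ultimately have "(z - p) / h = exp (Complex s t)"
          by (simp add: Complex_eq exp_add exp_of_real)
        then have "z = p + ph (s,t)" using h by (simp add: ph_def field_simps)
        then show ?thesis using t by auto
      qed
      have R0: "R > 0" using R norm_ge_zero[of h] by linarith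
      have "\<exists>z\<in>sphere p R. M \<le> cmod (g z - g c)"
        using max_modulus_on_sphere[OF cg inj R0, of p "g c"] by (simp add: M_def p_def)
      then obtain y where y: "y \<in> {0..2*pi}" "M \<le> cmod (F (s,y))"
        unfolding F_def using polar by blast
      have "c \<in> ball p R" "c + h \<notin> ball p R"
        using R by (auto simp: p_def dist_norm norm_minus_commute mult_2[symmetric] norm_mult)
      from min_modulus_on_sphere[OF cg inj this]
      have "\<exists>z\<in>sphere p R. cmod (g z - g c) \<le> e" by (simp add: e_def)
      then obtain x where x: "x \<in> {0..2*pi}" "cmod (F (s,x)) \<le> e"
        unfolding F_def using polar by blast
      have der_t: "((\<lambda>t. F (s,t)) has_vector_derivative Ft (s,t)) (at t)" for t
      proof -
        have "((\<lambda>t. (s,t)) has_derivative (\<lambda>v. (0,v))) (at t)" by (auto intro!: derivative_eq_intros)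
        from has_derivative_compose[OF this derF] show ?thesis by (simp add: has_vector_derivative_def)
      qed
      have cont_t: "continuous_on UNIV (\<lambda>t. Ft (s,t))"
        by (rule continuous_on_compose2[OF cFt[of UNIV]]) (auto intro: continuous_intros)
      have ms[measurable]: "(\<lambda>t. (s,t)) \<in> borel_measurable lborel" by measurable
      define G where "G = (\<lambda>t. ennreal (cmod (Ft (s,t)) / cmod (F (s,t))) * indicator E (s,t))"
      have mG[measurable]: "G \<in> borel_measurable lborel" unfolding G_def by measurable
      have "ennreal L \<le> (\<integral>\<^sup>+t. ennreal (cmod (Ft (s,t)) / cmod (F (s,t))) * indicator {t. 0 \<le> t \<and> t \<le> 2*pi \<and> e \<le> cmod (F (s,t)) \<and> cmod (F (s,t)) \<le> M} t \<partial>lborel)"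
        unfolding L_def by (rule log_length_crossing[OF der_t cont_t e less_imp_le[OF eM] x y])
      also have "\<dots> = (\<integral>\<^sup>+t. G t * indicator {0..2*pi} t \<partial>lborel)"
      proof (rule nn_integral_cong_AE)
        have "AE t in lborel. t \<noteq> 2*pi" by (rule AE_lborel_singleton)
        then show "AE t in lborel. ennreal (cmod (Ft (s,t)) / cmod (F (s,t))) * indicator {t. 0 \<le> t \<and> t \<le> 2*pi \<and> e \<le> cmod (F (s,t)) \<and> cmod (F (s,t)) \<le> M} t
            = G t * indicator {0..2*pi} t"
          by eventually_elim (use s in \<open>auto simp: G_def E_def indicator_def space_pair_measure\<close>)
      qed
      finally have "(ennreal L)\<^sup>2 \<le> (\<integral>\<^sup>+t. G t * indicator {0..2*pi} t \<partial>lborel)\<^sup>2" by (rule power_mono) simp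
      also have "\<dots> \<le> (\<integral>\<^sup>+t. (G t)\<^sup>2 \<partial>lborel) * (\<integral>\<^sup>+t. (indicator {0..2*pi} t)\<^sup>2 \<partial>lborel)"
        by (rule Cauchy_Schwarz_nn_integral) auto
      also have "(\<integral>\<^sup>+t. (indicator {0..2*pi} t)\<^sup>2 \<partial>lborel) = (\<integral>\<^sup>+t. indicator {0..2*pi} t \<partial>lborel)"
        by (intro nn_integral_cong) (auto simp: indicator_def)
      also have "\<dots> = ennreal (2*pi)" by simp
      also have "(\<integral>\<^sup>+t. (G t)\<^sup>2 \<partial>lborel) \<le> (\<integral>\<^sup>+t. ennreal K * (ennreal (Q (s,t)) * indicator E (s,t)) \<partial>lborel)"
      proof (rule nn_integral_mono)
        fix t
        have "(cmod (Ft (s,t)) / cmod (F (s,t)))\<^sup>2 \<le> K * Q (s,t)"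
          using Jdil[of "(s,t)"] by (simp add: Q_def power_divide divide_right_mono)
        then show "(G t)\<^sup>2 \<le> ennreal K * (ennreal (Q (s,t)) * indicator E (s,t))"
          using K Q0 by (auto simp: G_def indicator_def ennreal_power ennreal_mult'[symmetric] intro!: ennreal_leI)
      qed
      also have "\<dots> = ennreal K * (\<integral>\<^sup>+t. ennreal (Q (s,t)) * indicator E (s,t) \<partial>lborel)"
        by (rule nn_integral_cmult) measurable
      finally have "ennreal (L\<^sup>2) \<le> ennreal K * (\<integral>\<^sup>+t. ennreal (Q (s,t)) * indicator E (s,t) \<partial>lborel) * ennreal (2*pi)"
        using L by (simp add: ennreal_power mult_right_mono)
      also have "\<dots> = ennreal (2*pi*K) * (\<integral>\<^sup>+t. ennreal (Q (s,t)) * indicator E (s,t) \<partial>lborel)"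
        using K by (simp add: ennreal_mult' mult_ac)
      finally show ?thesis .
    qed
    have "ennreal (L\<^sup>2 * ln 2) = (\<integral>\<^sup>+s. ennreal (L\<^sup>2) * indicator {0<..<ln 2} (s::real) \<partial>lborel)"
      by (simp add: nn_integral_cmult ennreal_mult')
    also have "\<dots> \<le> (\<integral>\<^sup>+s. ennreal (2 * pi * K) * (\<integral>\<^sup>+t. ennreal (Q (s,t)) * indicator E (s,t) \<partial>lborel) \<partial>lborel)"
      using length by (intro nn_integral_mono) (auto simp: indicator_def)
    also have "\<dots> = ennreal (2 * pi * K) * (\<integral>\<^sup>+s. (\<integral>\<^sup>+t. ennreal (Q (s,t)) * indicator E (s,t) \<partial>lborel) \<partial>lborel)"
      by (intro nn_integral_cmult) measurable
    also have "(\<integral>\<^sup>+s. (\<integral>\<^sup>+t. ennreal (Q (s,t)) * indicator E (s,t) \<partial>lborel) \<partial>lborel) = (\<integral>\<^sup>+x. ennreal (Q x) * indicator E x \<partial>(lborel \<Otimes>\<^sub>M lborel))"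
      by (rule lborel.nn_integral_fst) (auto simp: lborel_prod)
    also have "\<dots> \<le> ennreal (4 * pi * L)" using area by (simp add: lborel_prod)
    finally have "ennreal (L\<^sup>2 * ln 2) \<le> ennreal (2 * pi * K) * ennreal (4 * pi * L)" by (simp add: mult_left_mono)
    then have "ennreal (L\<^sup>2 * ln 2) \<le> ennreal (2 * pi * K * (4 * pi * L))"
      by (subst ennreal_mult') (use K in auto)
    then have "L\<^sup>2 * ln 2 \<le> 2 * pi * K * (4 * pi * L)" using K L by (subst (asm) ennreal_le_iff) auto
    then have "L * (L * ln 2) \<le> L * (8 * pi\<^sup>2 * K)" by (simp add: power2_eq_square algebra_simps)
    then have "L * ln 2 \<le> 8 * pi\<^sup>2 * K" using L by simp
    then have "L \<le> 8 * pi\<^sup>2 * K / ln 2" by (simp add: field_simps)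
    then have "exp L \<le> exp (8 * pi\<^sup>2 * K / ln 2)" by simp
    moreover have "exp L = M / e" using e eM by (simp add: L_def)
    ultimately have "M \<le> exp (8 * pi\<^sup>2 * K / ln 2) * e" using e by (simp add: field_simps)
    then show ?thesis by (simp add: M_def e_def K_def)
  qed
qed

section \<open>Mollification\<close>

text \<open>The case \<open>m = 0\<close> is the standard smooth function that is flat at 0. Its derivatives of all orders are linear
combinations of members of this family.\<close>

definition flat_exp :: "nat \<Rightarrow> real \<Rightarrow> real" where
  "flat_exp m t = (if t > 0 then inverse t ^ m * exp (- inverse t) else 0)"

lemma flat_exp_tendsto_0: "(flat_exp m \<longlongrightarrow> 0) (at 0)"
proof -
  have "((\<lambda>t. inverse t ^ m / exp (inverse t)) \<longlongrightarrow> (0::real)) (at_right 0)"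
    by (rule filterlim_compose[OF tendsto_power_div_exp_0 filterlim_inverse_at_top_right])
  moreover have "\<forall>\<^sub>F t in at_right 0. inverse t ^ m / exp (inverse t) = flat_exp m t"
    unfolding eventually_at_right_field
    by (intro exI[of _ 1]) (simp add: flat_exp_def exp_minus divide_inverse)
  ultimately have "(flat_exp m \<longlongrightarrow> 0) (at_right 0)" by (rule Lim_transform_eventually)
  moreover have "(flat_exp m \<longlongrightarrow> 0) (at_left 0)"
    by (rule tendsto_eventually) (auto simp: flat_exp_def eventually_at_left_field intro!: exI[of _ "-1"])
  ultimately show ?thesis by (simp only: filterlim_at_split)
qed

lemma flat_exp_has_derivative:
  "(flat_exp m has_real_derivative flat_exp (m + 2) t - real m * flat_exp (m + 1) t) (at t)"
proof -
  consider "t > 0" | "t < 0" | "t = 0" by linarith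
  then show ?thesis
  proof cases
    case 1
    define x where "x = inverse t"
    have x: "((\<lambda>x. x ^ m * exp (- x)) has_real_derivative (real m * x ^ (m - 1) - x ^ m) * exp (- x)) (at x)"
      by (auto intro!: derivative_eq_intros simp: algebra_simps)
    have "(inverse has_real_derivative - x\<^sup>2) (at t)"
      using DERIV_inverse[of t UNIV] 1 unfolding x_def numeral_2_eq_2 by blast
    from DERIV_chain2[OF x[unfolded x_def] this]
    have der: "((\<lambda>t. inverse t ^ m * exp (- inverse t)) has_real_derivative (real m * x ^ (m - 1) - x ^ m) * exp (- x) * - x\<^sup>2) (at t)"
      by (simp only: x_def)
    have "real m * x ^ (m - 1) * x\<^sup>2 = real m * x ^ (m + 1)"
      by (cases m) (simp_all add: power2_eq_square)
    moreover have "flat_exp n t = x ^ n * exp (- x)" for n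
      using 1 by (simp only: flat_exp_def x_def if_True)
    ultimately have "(real m * x ^ (m - 1) - x ^ m) * exp (- x) * - x\<^sup>2 = flat_exp (m + 2) t - real m * flat_exp (m + 1) t"
    proof -
      assume a: "real m * x ^ (m - 1) * x\<^sup>2 = real m * x ^ (m + 1)" and b: "\<And>n. flat_exp n t = x ^ n * exp (- x)"
      have e: "(p - q) * v * - y = q * y * v - p * y * v" for p q v y :: real by (simp add: algebra_simps)
      show ?thesis
        unfolding e[of "real m * x ^ (m - 1)" "x ^ m" "exp (- x)" "x\<^sup>2"] a b by (simp only: power_add mult.assoc)
    qed
    note eq = this
    have "((\<lambda>t. inverse t ^ m * exp (- inverse t)) has_real_derivative flat_exp (m + 2) t - real m * flat_exp (m + 1) t) (at t)"
      using der unfolding eq .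
    then show ?thesis
      by (rule has_field_derivative_transform_within_open[where S="{0<..}"])
        (use 1 in \<open>simp_all only: flat_exp_def if_True greaterThan_iff open_greaterThan\<close>)
  next
    case 2
    have "((\<lambda>t. 0) has_real_derivative flat_exp (m + 2) t - real m * flat_exp (m + 1) t) (at t)"
      using 2 by (auto simp: flat_exp_def)
    then show ?thesis
      by (rule has_field_derivative_transform_within_open[where S="{..<0}"]) (use 2 in \<open>auto simp: flat_exp_def\<close>)
  next
    case 3
    have eq0: "(\<lambda>h. (flat_exp m (0 + h) - flat_exp m 0) / h) = flat_exp (m + 1)"
      by (rule ext) (simp add: flat_exp_def field_simps)
    have "((\<lambda>h. (flat_exp m (0 + h) - flat_exp m 0) / h) \<longlongrightarrow> 0) (at 0)"
      unfolding eq0 by (intro flat_exp_tendsto_0)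
    then have "(flat_exp m has_real_derivative 0) (at 0)" by (simp only: DERIV_def)
    then show ?thesis by (simp add: 3 flat_exp_def[of _ 0])
  qed
qed

text \<open>A set of functions that contains the standard bump function and is closed under partial differentiation. It
replaces an explicit formula for the derivatives of the bump function of all orders.\<close>

inductive_set bumps :: "real \<Rightarrow> (complex \<Rightarrow> real) set" for r :: real where
  base: "(\<lambda>w. flat_exp m (1 - r * (cmod w)\<^sup>2)) \<in> bumps r"
| Re: "f \<in> bumps r \<Longrightarrow> (\<lambda>w. Re w * f w) \<in> bumps r"
| Im: "f \<in> bumps r \<Longrightarrow> (\<lambda>w. Im w * f w) \<in> bumps r"
| scale: "f \<in> bumps r \<Longrightarrow> (\<lambda>w. c * f w) \<in> bumps r"
| add: "f \<in> bumps r \<Longrightarrow> g \<in> bumps r \<Longrightarrow> (\<lambda>w. f w + g w) \<in> bumps r"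

lemma bumps_derivativeI:
  assumes "fx \<in> bumps r" "fy \<in> bumps r" "\<And>w. (f has_derivative (\<lambda>h. Re h * fx w + Im h * fy w)) (at w)"
  shows "\<exists>fx\<in>bumps r. \<exists>fy\<in>bumps r. \<forall>w. (f has_derivative (\<lambda>h. Re h * fx w + Im h * fy w)) (at w)"
  using assms by blast

lemma bumps_derivative:
  assumes "f \<in> bumps r"
  shows "\<exists>fx\<in>bumps r. \<exists>fy\<in>bumps r. \<forall>w. (f has_derivative (\<lambda>h. Re h * fx w + Im h * fy w)) (at w)"
  using assms
proof induction
  case (base m)
  define f' where "f' = (\<lambda>w. flat_exp (m+2) (1 - r * (cmod w)\<^sup>2) + (- real m) * flat_exp (m+1) (1 - r * (cmod w)\<^sup>2))"
  have f': "f' \<in> bumps r" unfolding f'_def by (intro bumps.add bumps.scale bumps.base)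
  have "((\<lambda>w. flat_exp m (1 - r * (cmod w)\<^sup>2)) has_derivative
      (\<lambda>h. Re h * ((-2*r) * (Re w * f' w)) + Im h * ((-2*r) * (Im w * f' w)))) (at w)" for w
  proof -
    have "((\<lambda>w. 1 - r * (cmod w)\<^sup>2) has_derivative (\<lambda>h. - r * (2 * Re w * Re h + 2 * Im w * Im h))) (at w)"
      unfolding cmod_power2 by (auto intro!: derivative_eq_intros simp: fun_eq_iff algebra_simps)
    from has_derivative_compose[OF this flat_exp_has_derivative[THEN has_field_derivative_imp_has_derivative]]
    show ?thesis by (rule has_derivative_eq_rhs) (auto simp: f'_def fun_eq_iff algebra_simps)
  qed
  then show ?case
    by (rule bumps_derivativeI[OF bumps.scale[OF bumps.Re[OF f']] bumps.scale[OF bumps.Im[OF f']]])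
next
  case (Re f)
  then obtain fx fy where *: "fx \<in> bumps r" "fy \<in> bumps r" "\<And>w. (f has_derivative (\<lambda>h. Re h * fx w + Im h * fy w)) (at w)" by blast
  have "((\<lambda>w. Re w * f w) has_derivative (\<lambda>h. Re h * (f w + Re w * fx w) + Im h * (Re w * fy w))) (at w)" for w
    by (rule has_derivative_eq_rhs[OF has_derivative_mult[OF has_derivative_Re[OF has_derivative_ident] *(3)]])
      (simp add: fun_eq_iff algebra_simps)
  then show ?case
    by (rule bumps_derivativeI[OF bumps.add[OF Re.hyps bumps.Re[OF *(1)]] bumps.Re[OF *(2)]])
next
  case (Im f)
  then obtain fx fy where *: "fx \<in> bumps r" "fy \<in> bumps r" "\<And>w. (f has_derivative (\<lambda>h. Re h * fx w + Im h * fy w)) (at w)" by blast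
  have "((\<lambda>w. Im w * f w) has_derivative (\<lambda>h. Re h * (Im w * fx w) + Im h * (f w + Im w * fy w))) (at w)" for w
    by (rule has_derivative_eq_rhs[OF has_derivative_mult[OF has_derivative_Im[OF has_derivative_ident] *(3)]])
      (simp add: fun_eq_iff algebra_simps)
  then show ?case
    by (rule bumps_derivativeI[OF bumps.Im[OF *(1)] bumps.add[OF Im.hyps bumps.Im[OF *(2)]]])
next
  case (scale f c)
  then obtain fx fy where *: "fx \<in> bumps r" "fy \<in> bumps r" "\<And>w. (f has_derivative (\<lambda>h. Re h * fx w + Im h * fy w)) (at w)" by blast
  have "((\<lambda>w. c * f w) has_derivative (\<lambda>h. Re h * (c * fx w) + Im h * (c * fy w))) (at w)" for w
    by (rule has_derivative_eq_rhs[OF has_derivative_mult_right[OF *(3)]]) (simp add: fun_eq_iff algebra_simps)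
  then show ?case by (rule bumps_derivativeI[OF bumps.scale[OF *(1)] bumps.scale[OF *(2)]])
next
  case (add f g)
  then obtain fx fy gx gy where *: "fx \<in> bumps r" "fy \<in> bumps r" "\<And>w. (f has_derivative (\<lambda>h. Re h * fx w + Im h * fy w)) (at w)"
    "gx \<in> bumps r" "gy \<in> bumps r" "\<And>w. (g has_derivative (\<lambda>h. Re h * gx w + Im h * gy w)) (at w)" by blast
  have "((\<lambda>w. f w + g w) has_derivative (\<lambda>h. Re h * (fx w + gx w) + Im h * (fy w + gy w))) (at w)" for w
    by (rule has_derivative_eq_rhs[OF has_derivative_add[OF *(3) *(6)]]) (simp add: fun_eq_iff algebra_simps)
  then show ?case by (rule bumps_derivativeI[OF bumps.add[OF *(1) *(4)] bumps.add[OF *(2) *(5)]])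
qed

lemma bumps_continuous: "K \<in> bumps r \<Longrightarrow> continuous_on S K"
  using bumps_derivative by (meson continuous_at_imp_continuous_on has_derivative_continuous)

lemma bumps_support: "K \<in> bumps r \<Longrightarrow> 1 \<le> r * (cmod w)\<^sup>2 \<Longrightarrow> K w = 0"
  by (induction rule: bumps.induct) (auto simp: flat_exp_def)

lemma bumps_support_cball:
  assumes "K \<in> bumps r" "r > 0" "w \<notin> cball 0 (1 / sqrt r)"
  shows "K w = 0"
proof (rule bumps_support[OF assms(1)])
  have "1 / sqrt r \<le> cmod w" using assms by simp
  then have "(1 / sqrt r)\<^sup>2 \<le> (cmod w)\<^sup>2" using assms by (intro power_mono) auto
  then show "1 \<le> r * (cmod w)\<^sup>2" using assms by (simp add: power_divide field_simps)
qed

text \<open>By induction on the order, since the partial derivatives are again in the set; the translation is needed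
because the kernel of a mollification at \<open>z\<close> is centred at \<open>z\<close>.\<close>

lemma bumps_C_k: "K \<in> bumps r \<Longrightarrow> C_k k (\<lambda>w. K (w - z))"
proof (induction k arbitrary: K)
  case 0
  have "continuous_on UNIV (\<lambda>w. w - z)" by (intro continuous_intros)
  from continuous_on_compose2[OF bumps_continuous[OF 0] this, of UNIV] show ?case by simp
next
  case (Suc k)
  from bumps_derivative[OF Suc.prems] obtain Kx Ky where *: "Kx \<in> bumps r" "Ky \<in> bumps r"
    "\<And>w. (K has_derivative (\<lambda>h. Re h * Kx w + Im h * Ky w)) (at w)" by blast
  have "((\<lambda>w. K (w - z)) has_derivative (\<lambda>h. Re h * Kx (w - z) + Im h * Ky (w - z))) (at w)" for w
  proof -
    have "((\<lambda>w. w - z) has_derivative (\<lambda>h. h)) (at w)" by (auto intro!: derivative_eq_intros)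
    from has_derivative_compose[OF this *(3)] show ?thesis .
  qed
  then have "\<forall>w. ((\<lambda>w. K (w - z)) has_derivative (\<lambda>h. Re h * Kx (w - z) + Im h * Ky (w - z))) (at w)"
    by blast
  then show ?case unfolding C_k.simps
    using Suc.IH[OF *(1)] Suc.IH[OF *(2)]
    apply -
    apply (rule exI[where x="\<lambda>w. Kx (w - z)"])
    apply (rule exI[where x="\<lambda>w. Ky (w - z)"])
    apply (intro conjI; assumption)
    done
qed

lemma bumps_test_function:
  assumes K: "K \<in> bumps r" and r: "r > 0"
  shows "test_function (\<lambda>w. K (w - z))"
proof -
  have "{w. K (w - z) \<noteq> 0} \<subseteq> cball z (1 / sqrt r)"
  proof
    fix w assume "w \<in> {w. K (w - z) \<noteq> 0}"
    then have "w - z \<in> cball 0 (1 / sqrt r)" using bumps_support_cball[OF K r] by blast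
    then show "w \<in> cball z (1 / sqrt r)" by (simp add: dist_norm norm_minus_commute)
  qed
  then have "compact (closure {w. K (w - z) \<noteq> 0})"
    by (meson bounded_cball bounded_subset compact_closure)
  then show ?thesis using bumps_C_k[OF K] by (simp add: test_function_def)
qed

text \<open>Convolution with the reflected kernel; \<open>K\<close> is not normalised.\<close>

definition mollify :: "(complex \<Rightarrow> real) \<Rightarrow> (complex \<Rightarrow> complex) \<Rightarrow> complex \<Rightarrow> complex" where
  "mollify K g z = (LINT w|lebesgue. K (w - z) *\<^sub>R g w)"

lemma bumps_shift_continuous:
  assumes "K \<in> bumps r" shows "continuous_on S (\<lambda>w. K (w - z))"
proof -
  have "continuous_on S (\<lambda>w. w - z)" by (intro continuous_intros)
  from continuous_on_compose2[OF bumps_continuous[OF assms] this, of UNIV] show ?thesis by simp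
qed

lemma bumps_bounded:
  assumes K: "K \<in> bumps r" and r: "r > 0"
  obtains B where "\<And>w. \<bar>K w\<bar> \<le> B"
proof -
  have "compact (K ` cball 0 (1 / sqrt r))" by (intro compact_continuous_image bumps_continuous[OF K]) auto
  then obtain B where B: "\<forall>y\<in>K ` cball 0 (1 / sqrt r). norm y \<le> B" using compact_imp_bounded bounded_iff by metis
  have "\<bar>K w\<bar> \<le> max B 0" for w
  proof (cases "w \<in> cball 0 (1 / sqrt r)")
    case True
    then have "norm (K w) \<le> B" using B by blast
    then show ?thesis by simp
  next
    case False
    from bumps_support_cball[OF K r this] show ?thesis by simp
  qed
  then show ?thesis by (rule that)
qed

lemma bumps_shift_support:
  assumes "K \<in> bumps r" "r > 0" "w \<notin> cball z (1 / sqrt r)"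
  shows "K (w - z) = 0"
  using assms by (intro bumps_support_cball[of K r]) (auto simp: dist_norm norm_minus_commute)

lemma mollify_integrable:
  assumes K: "K \<in> bumps r" and r: "r > 0" and g: "L1_loc g"
  shows "integrable lebesgue (\<lambda>w. K (w - z) *\<^sub>R g w)"
proof -
  let ?S = "cball z (1 / sqrt r)"
  obtain B where B: "\<And>w. \<bar>K w\<bar> \<le> B" using bumps_bounded[OF K r] by metis
  have si: "integrable lebesgue (\<lambda>w. indicator ?S w *\<^sub>R g w)"
    using g by (simp add: L1_loc_def set_integrable_def)
  have eq: "(\<lambda>w. K (w - z) *\<^sub>R g w) = (\<lambda>w. K (w - z) *\<^sub>R (indicator ?S w *\<^sub>R g w))"
    using bumps_shift_support[OF K r] by (auto simp: fun_eq_iff indicator_def)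
  have "(\<lambda>w. K (w - z)) \<in> borel_measurable borel"
    by (intro borel_measurable_continuous_onI bumps_shift_continuous[OF K])
  then have mK: "(\<lambda>w. K (w - z)) \<in> borel_measurable lebesgue"
    by (intro measurable_completion) simp
  show ?thesis unfolding eq
  proof (rule Bochner_Integration.integrable_bound)
    show "integrable lebesgue (\<lambda>w. B *\<^sub>R (indicator ?S w *\<^sub>R g w))"
      by (intro integrable_scaleR_right si)
    show "(\<lambda>w. K (w - z) *\<^sub>R (indicator ?S w *\<^sub>R g w)) \<in> borel_measurable lebesgue"
      using mK borel_measurable_integrable[OF si] by (rule borel_measurable_scaleR)
    show "AE w in lebesgue. norm (K (w - z) *\<^sub>R (indicator ?S w *\<^sub>R g w)) \<le> norm (B *\<^sub>R (indicator ?S w *\<^sub>R g w))"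
    proof (rule AE_I2)
      fix w
      have "\<bar>K (w - z)\<bar> \<le> \<bar>B\<bar>" using B[of "w - z"] by linarith
      from mult_right_mono[OF this norm_ge_zero[of "indicator ?S w *\<^sub>R g w"]]
      show "norm (K (w - z) *\<^sub>R (indicator ?S w *\<^sub>R g w)) \<le> norm (B *\<^sub>R (indicator ?S w *\<^sub>R g w))"
        by (simp only: norm_scaleR)
    qed
  qed
qed

lemma mollify_eq_integral_cbox:
  assumes K: "K \<in> bumps r" and r: "r > 0" and g: "continuous_on UNIV g" and S: "cball z (1 / sqrt r) \<subseteq> cbox a b"
  shows "mollify K g z = integral (cbox a b) (\<lambda>w. K (w - z) *\<^sub>R g w)"
proof -
  have "continuous_on (cbox a b) (\<lambda>w. K (w - z) *\<^sub>R g w)"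
    by (intro continuous_intros bumps_shift_continuous[OF K] continuous_on_subset[OF g]) auto
  then have "(\<lambda>w. K (w - z) *\<^sub>R g w) absolutely_integrable_on cbox a b" by (rule absolutely_integrable_continuous)
  then have "(LINT w:cbox a b|lebesgue. K (w - z) *\<^sub>R g w) = integral (cbox a b) (\<lambda>w. K (w - z) *\<^sub>R g w)"
    by (rule set_lebesgue_integral_eq_integral)
  moreover have "(\<lambda>w. indicator (cbox a b) w *\<^sub>R (K (w - z) *\<^sub>R g w)) = (\<lambda>w. K (w - z) *\<^sub>R g w)"
    using bumps_shift_support[OF K r] S by (fastforce simp: fun_eq_iff indicator_def)
  ultimately show ?thesis by (simp add: mollify_def set_lebesgue_integral_def)
qed

text \<open>Differentiation under the integral sign. The derivative falls on the kernel, whose argument \<open>w - z\<close>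
produces the minus sign.\<close>

lemma mollify_has_derivative:
  assumes K: "K \<in> bumps r" "Kx \<in> bumps r" "Ky \<in> bumps r" and r: "r > 0"
    and dK: "\<And>w. (K has_derivative (\<lambda>h. Re h * Kx w + Im h * Ky w)) (at w)"
    and g: "continuous_on UNIV g"
  shows "(mollify K g has_derivative (\<lambda>h. - (Re h *\<^sub>R mollify Kx g z + Im h *\<^sub>R mollify Ky g z))) (at z)"
proof -
  define BRe :: "complex \<Rightarrow>\<^sub>L real" where "BRe = Blinfun Re"
  define BIm :: "complex \<Rightarrow>\<^sub>L real" where "BIm = Blinfun Im"
  have BRe[simp]: "blinfun_apply BRe h = Re h" and BIm[simp]: "blinfun_apply BIm h = Im h" for h
    by (simp_all add: BRe_def BIm_def bounded_linear_Blinfun_apply bounded_linear_Re bounded_linear_Im)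
  define D where "D = (\<lambda>x w. - ((blinfun_scaleR_left (Kx (w - x) *\<^sub>R g w) o\<^sub>L BRe) + (blinfun_scaleR_left (Ky (w - x) *\<^sub>R g w) o\<^sub>L BIm)))"
  have Dapp: "blinfun_apply (D x w) h = - (Re h *\<^sub>R (Kx (w - x) *\<^sub>R g w) + Im h *\<^sub>R (Ky (w - x) *\<^sub>R g w))" for x w h
    by (simp add: D_def blinfun.bilinear_simps)
  have "bounded (cball z (1 + 1 / sqrt r))" by simp
  then obtain a where a: "cball z (1 + 1 / sqrt r) \<subseteq> cbox (-a) a" using bounded_subset_cbox_symmetric by blast
  have sub: "cball x (1 / sqrt r) \<subseteq> cbox (-a) a" if "x \<in> ball z 1" for x
  proof
    fix w assume "w \<in> cball x (1 / sqrt r)"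
    then have "dist z w \<le> 1 + 1 / sqrt r" using that dist_triangle[of z w x] by simp
    then show "w \<in> cbox (-a) a" using a by auto
  qed
  have cs: "continuous_on S (\<lambda>p. k (snd p - fst p))" if "k \<in> bumps r" for k and S :: "(complex \<times> complex) set"
    by (rule continuous_on_compose2[OF bumps_continuous[OF that, of UNIV]]) (auto intro!: continuous_intros)
  have cgs: "continuous_on S (\<lambda>p. g (snd p))" for S :: "(complex \<times> complex) set"
    by (rule continuous_on_compose2[OF g]) (auto intro!: continuous_intros)
  have cD: "continuous_on (ball z 1 \<times> cbox (-a) a) (\<lambda>(x, w). D x w)"
    unfolding D_def split_beta by (intro continuous_intros cs cgs K)
  have "((\<lambda>x. integral (cbox (-a) a) (\<lambda>w. K (w - x) *\<^sub>R g w)) has_derivative blinfun_apply (integral (cbox (-a) a) (D z))) (at z within ball z 1)"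
  proof (rule leibniz_rule[OF _ _ cD])
    fix x w assume "x \<in> ball z 1" "w \<in> cbox (-a) a"
    have "((\<lambda>x. w - x) has_derivative (\<lambda>h. - h)) (at x within ball z 1)" by (auto intro!: derivative_eq_intros)
    from has_derivative_compose[OF this dK]
    have "((\<lambda>x. K (w - x)) has_derivative (\<lambda>h. - (Re h * Kx (w - x) + Im h * Ky (w - x)))) (at x within ball z 1)"
      by simp
    from has_derivative_scaleR_left[OF this, of "g w"]
    show "((\<lambda>x. K (w - x) *\<^sub>R g w) has_derivative blinfun_apply (D x w)) (at x within ball z 1)"
      by (rule has_derivative_eq_rhs) (simp add: fun_eq_iff Dapp algebra_simps)
  next
    fix x
    have "continuous_on (cbox (-a) a) (\<lambda>w. K (w - x) *\<^sub>R g w)"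
      by (intro continuous_intros bumps_shift_continuous[OF K(1)] continuous_on_subset[OF g]) auto
    then show "(\<lambda>w. K (w - x) *\<^sub>R g w) integrable_on cbox (-a) a" by (rule integrable_continuous)
  qed auto
  then have "((\<lambda>x. integral (cbox (-a) a) (\<lambda>w. K (w - x) *\<^sub>R g w)) has_derivative blinfun_apply (integral (cbox (-a) a) (D z))) (at z)"
    by (simp add: at_within_open[OF _ open_ball])
  then have "(mollify K g has_derivative blinfun_apply (integral (cbox (-a) a) (D z))) (at z)"
    by (rule has_derivative_transform_within_open[where s="ball z 1"])
      (use mollify_eq_integral_cbox[OF K(1) r g sub] in auto)
  moreover have "blinfun_apply (integral (cbox (-a) a) (D z)) h = - (Re h *\<^sub>R mollify Kx g z + Im h *\<^sub>R mollify Ky g z)" for h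
  proof -
    have "continuous_on (cbox (-a) a) (\<lambda>w. (z, w))" by (intro continuous_intros)
    moreover have "(\<lambda>w. (z, w)) ` cbox (-a) a \<subseteq> ball z 1 \<times> cbox (-a) a" by auto
    ultimately have "continuous_on (cbox (-a) a) (\<lambda>w. (\<lambda>(x, w). D x w) (z, w))"
      by (rule continuous_on_compose2[OF cD])
    then have "continuous_on (cbox (-a) a) (D z)" by simp
    then have iD: "D z integrable_on cbox (-a) a" by (rule integrable_continuous)
    have ig: "(\<lambda>w. k (w - z) *\<^sub>R g w) integrable_on cbox (-a) a" if "k \<in> bumps r" for k
      by (intro integrable_continuous continuous_intros bumps_shift_continuous[OF that] continuous_on_subset[OF g]) auto
    have "blinfun_apply (integral (cbox (-a) a) (D z)) h = integral (cbox (-a) a) (\<lambda>w. blinfun_apply (D z w) h)"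
      using iD by (rule blinfun_apply_integral)
    also have "\<dots> = - (Re h *\<^sub>R integral (cbox (-a) a) (\<lambda>w. Kx (w - z) *\<^sub>R g w) + Im h *\<^sub>R integral (cbox (-a) a) (\<lambda>w. Ky (w - z) *\<^sub>R g w))"
      unfolding Dapp integral_neg integral_cmul[symmetric]
      by (subst Henstock_Kurzweil_Integration.integral_add) (intro integrable_cmul ig K refl)+
    finally show ?thesis
      using mollify_eq_integral_cbox[OF K(2) r g sub] mollify_eq_integral_cbox[OF K(3) r g sub] by simp
  qed
  ultimately show ?thesis by (simp add: fun_eq_iff has_derivative_eq_rhs)
qed

text \<open>The translated kernel is a test function, so the derivative can be moved from the kernel to the function.\<close>

lemma mollify_weak_derivative:
  assumes K: "K \<in> bumps r" and r: "r > 0"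
    and dK: "\<And>w. (K has_derivative (\<lambda>h. Re h * Kx w + Im h * Ky w)) (at w)"
    and g: "weak_derivative v g gv"
  shows "mollify (\<lambda>w. Re v * Kx w + Im v * Ky w) g z = - mollify K gv z"
proof -
  have "frechet_derivative (\<lambda>w. K (w - z)) (at w) v = Re v * Kx (w - z) + Im v * Ky (w - z)" for w
  proof -
    have "((\<lambda>w. w - z) has_derivative (\<lambda>h. h)) (at w)" by (auto intro!: derivative_eq_intros)
    from frechet_derivative_at[OF has_derivative_compose[OF this dK]] show ?thesis by metis
  qed
  moreover have "(LINT w|lebesgue. frechet_derivative (\<lambda>w. K (w - z)) (at w) v *\<^sub>R g w) = - (LINT w|lebesgue. K (w - z) *\<^sub>R gv w)"
    using g bumps_test_function[OF K r] by (auto simp: weak_derivative_def)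
  ultimately show ?thesis by (simp add: mollify_def)
qed

definition bump :: "real \<Rightarrow> complex \<Rightarrow> real" where
  "bump r w = flat_exp 0 (1 - r * (cmod w)\<^sup>2)"

lemma bump_in_bumps: "bump r \<in> bumps r"
  using bumps.base[of 0 r] by (simp add: bump_def[abs_def])

lemma bump_nonneg: "0 \<le> bump r w"
  by (simp add: bump_def flat_exp_def)

definition bump_mass :: "real \<Rightarrow> real" where
  "bump_mass r = (LINT w|lebesgue. bump r w)"

lemma bump_integrable:
  assumes "r > 0" shows "integrable lebesgue (\<lambda>w. bump r (w - z))"
proof -
  have "L1_loc (\<lambda>_. 1)"
    unfolding L1_loc_def set_integrable_def
    by (auto intro!: integrable_scaleR_left lmeasurable_iff_integrable[THEN iffD1] lmeasurable_compact)
  from integrable_Re[OF mollify_integrable[OF bump_in_bumps assms this]] show ?thesis by simp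
qed

lemma bump_mass_shift:
  assumes "r > 0" shows "(LINT w|lebesgue. bump r (w - z)) = bump_mass r"
proof -
  have m: "(\<lambda>w. bump r (w - y)) \<in> borel_measurable borel" for y
    by (intro borel_measurable_continuous_onI bumps_shift_continuous[OF bump_in_bumps])
  have "(LINT w|lebesgue. bump r (w - z)) = (LINT w|lborel. bump r (w - z))"
    using m by (intro integral_completion) simp
  also have "\<dots> = (LINT w|distr lborel borel ((+) z). bump r (w - z))" by (simp add: lborel_distr_plus)
  also have "\<dots> = (LINT w|lborel. bump r w)" using m by (subst integral_distr) auto
  also have "\<dots> = bump_mass r"
    unfolding bump_mass_def using m[of 0] by (intro integral_completion[symmetric]) simp
  finally show ?thesis .
qed

lemma bump_mass_pos:
  assumes "r > 0" shows "0 < bump_mass r"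
proof -
  have i: "integrable lebesgue (bump r)" using bump_integrable[OF assms, of 0] by simp
  have "0 \<le> bump_mass r" unfolding bump_mass_def by (intro integral_nonneg_AE AE_I2 bump_nonneg)
  moreover have "bump_mass r \<noteq> 0"
  proof
    assume "bump_mass r = 0"
    then have "AE w in lebesgue. bump r w = 0"
      unfolding bump_mass_def using integral_nonneg_eq_0_iff_AE[OF i] bump_nonneg by simp
    then have "AE w in lebesgue. w \<notin> ball (0::complex) (1 / sqrt r)"
    proof eventually_elim
      case (elim w)
      then have "1 \<le> r * (cmod w)\<^sup>2" by (simp add: bump_def flat_exp_def split: if_splits)
      then have "1 / r \<le> (cmod w)\<^sup>2" using assms by (simp add: field_simps)
      from real_sqrt_le_mono[OF this] show ?case by (simp add: real_sqrt_divide)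
    qed
    then have "negligible (ball (0::complex) (1 / sqrt r))"
      by (simp add: negligible_iff_null_sets AE_iff_null_sets)
    then show False using open_not_negligible[of "ball (0::complex) (1 / sqrt r)"] assms by simp
  qed
  ultimately show ?thesis by simp
qed

text \<open>The condition \<open>\<bar>b\<bar> \<le> k * Re a\<close> describes a convex cone of pairs \<open>(a, b)\<close>, and an average with nonnegative
weights of vectors in a convex cone stays in the cone.\<close>

lemma mollify_cone:
  assumes r: "r > 0" and L: "L1_loc fx" "L1_loc fy"
    and cone: "AE w in lebesgue. cmod (wirtinger_bar (fx w) (fy w)) \<le> k * Re (wirtinger (fx w) (fy w))"
  shows "cmod (wirtinger_bar (mollify (bump r) fx z) (mollify (bump r) fy z))
    \<le> k * Re (wirtinger (mollify (bump r) fx z) (mollify (bump r) fy z))"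
proof -
  define K where "K = (\<lambda>w. bump r (w - z))"
  have ix: "integrable lebesgue (\<lambda>w. K w *\<^sub>R fx w)" and iy: "integrable lebesgue (\<lambda>w. K w *\<^sub>R fy w)"
    unfolding K_def by (intro mollify_integrable[OF bump_in_bumps r] L)+
  have mx: "mollify (bump r) fx z = (LINT w|lebesgue. K w *\<^sub>R fx w)"
    and my: "mollify (bump r) fy z = (LINT w|lebesgue. K w *\<^sub>R fy w)" by (simp_all add: mollify_def K_def)
  have eqb: "K w *\<^sub>R wirtinger_bar (fx w) (fy w) = (K w *\<^sub>R fx w + \<i> * (K w *\<^sub>R fy w)) / 2"
    and eq: "K w *\<^sub>R wirtinger (fx w) (fy w) = (K w *\<^sub>R fx w - \<i> * (K w *\<^sub>R fy w)) / 2" for w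
    by (auto simp: wirtinger_bar_def wirtinger_def scaleR_conv_of_real algebra_simps)
  have iyi: "integrable lebesgue (\<lambda>w. \<i> * (K w *\<^sub>R fy w))" using iy by (intro integrable_mult_right)
  have ib: "integrable lebesgue (\<lambda>w. K w *\<^sub>R wirtinger_bar (fx w) (fy w))"
    and i: "integrable lebesgue (\<lambda>w. K w *\<^sub>R wirtinger (fx w) (fy w))"
    unfolding eqb eq
    by (intro integrable_divide Bochner_Integration.integrable_add Bochner_Integration.integrable_diff ix iyi)+
  have "(LINT w|lebesgue. K w *\<^sub>R wirtinger_bar (fx w) (fy w)) = ((LINT w|lebesgue. K w *\<^sub>R fx w) + \<i> * (LINT w|lebesgue. K w *\<^sub>R fy w)) / 2"
    and "(LINT w|lebesgue. K w *\<^sub>R wirtinger (fx w) (fy w)) = ((LINT w|lebesgue. K w *\<^sub>R fx w) - \<i> * (LINT w|lebesgue. K w *\<^sub>R fy w)) / 2"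
    unfolding eqb eq integral_divide_zero Bochner_Integration.integral_add[OF ix iyi]
      Bochner_Integration.integral_diff[OF ix iyi] integral_mult_right_zero by (rule refl)+
  then have Ib: "wirtinger_bar (mollify (bump r) fx z) (mollify (bump r) fy z) = (LINT w|lebesgue. K w *\<^sub>R wirtinger_bar (fx w) (fy w))"
    and I: "wirtinger (mollify (bump r) fx z) (mollify (bump r) fy z) = (LINT w|lebesgue. K w *\<^sub>R wirtinger (fx w) (fy w))"
    by (simp_all only: mx my wirtinger_bar_def[of "LINT w|lebesgue. K w *\<^sub>R fx w"] wirtinger_def[of "LINT w|lebesgue. K w *\<^sub>R fx w"])
  have "cmod (LINT w|lebesgue. K w *\<^sub>R wirtinger_bar (fx w) (fy w)) \<le> (LINT w|lebesgue. cmod (K w *\<^sub>R wirtinger_bar (fx w) (fy w)))"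
    by (rule integral_norm_bound)
  also have "\<dots> \<le> (LINT w|lebesgue. k * Re (K w *\<^sub>R wirtinger (fx w) (fy w)))"
  proof (rule integral_mono_AE)
    show "AE w in lebesgue. cmod (K w *\<^sub>R wirtinger_bar (fx w) (fy w)) \<le> k * Re (K w *\<^sub>R wirtinger (fx w) (fy w))"
      using cone
    proof eventually_elim
      case (elim w)
      have "0 \<le> K w" by (simp add: K_def bump_nonneg)
      from mult_left_mono[OF elim this] show ?case using \<open>0 \<le> K w\<close> by (simp add: mult_ac)
    qed
    show "integrable lebesgue (\<lambda>w. cmod (K w *\<^sub>R wirtinger_bar (fx w) (fy w)))" by (rule integrable_norm[OF ib])
    show "integrable lebesgue (\<lambda>w. k * Re (K w *\<^sub>R wirtinger (fx w) (fy w)))"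
      by (intro integrable_mult_right integrable_Re i)
  qed
  also have "\<dots> = k * Re (LINT w|lebesgue. K w *\<^sub>R wirtinger (fx w) (fy w))"
    using i by (simp add: integral_Re del: scaleR_complex.simps)
  finally show ?thesis unfolding Ib I .
qed

lemma mollify_close:
  assumes r: "r > 0" and f: "L1_loc f" and e: "\<And>w. dist w z < 1 / sqrt r \<Longrightarrow> cmod (f w - f z) \<le> e"
  shows "cmod (mollify (bump r) f z /\<^sub>R bump_mass r - f z) \<le> e"
proof -
  define K where "K = (\<lambda>w. bump r (w - z))"
  have iK: "integrable lebesgue K" using bump_integrable[OF r] by (simp add: K_def)
  have i: "integrable lebesgue (\<lambda>w. K w *\<^sub>R f w)" unfolding K_def by (intro mollify_integrable[OF bump_in_bumps r f])
  have iz: "integrable lebesgue (\<lambda>w. K w *\<^sub>R f z)" using iK by (rule integrable_scaleR_left)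
  have mass: "(LINT w|lebesgue. K w) = bump_mass r" using bump_mass_shift[OF r] by (simp add: K_def)
  have c: "bump_mass r > 0" by (rule bump_mass_pos[OF r])
  have "mollify (bump r) f z - bump_mass r *\<^sub>R f z = (LINT w|lebesgue. K w *\<^sub>R f w - K w *\<^sub>R f z)"
  proof -
    have "mollify (bump r) f z = (LINT w|lebesgue. K w *\<^sub>R f w)" by (simp add: mollify_def K_def)
    then show ?thesis using i iz iK by (simp add: mass)
  qed
  also have "\<dots> = (LINT w|lebesgue. K w *\<^sub>R (f w - f z))" by (simp add: scaleR_diff_right)
  finally have "cmod (mollify (bump r) f z - bump_mass r *\<^sub>R f z) = cmod (LINT w|lebesgue. K w *\<^sub>R (f w - f z))" by simp
  also have "\<dots> \<le> (LINT w|lebesgue. cmod (K w *\<^sub>R (f w - f z)))" by (rule integral_norm_bound)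
  also have "\<dots> \<le> (LINT w|lebesgue. K w * e)"
  proof (rule integral_mono)
    have "integrable lebesgue (\<lambda>w. K w *\<^sub>R (f w - f z))"
      using Bochner_Integration.integrable_diff[OF i iz] by (simp add: scaleR_diff_right)
    then show "integrable lebesgue (\<lambda>w. cmod (K w *\<^sub>R (f w - f z)))" by (rule integrable_norm)
    show "integrable lebesgue (\<lambda>w. K w * e)" using iK by simp
    fix w
    have K0: "0 \<le> K w" by (simp add: K_def bump_nonneg)
    show "cmod (K w *\<^sub>R (f w - f z)) \<le> K w * e"
    proof (cases "dist w z < 1 / sqrt r")
      case True
      then show ?thesis using mult_left_mono[OF e[OF True] K0] K0 by simp
    next
      case False
      then have "(1 / sqrt r)\<^sup>2 \<le> (cmod (w - z))\<^sup>2" using r by (intro power_mono) (auto simp: dist_norm)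
      then have "1 \<le> r * (cmod (w - z))\<^sup>2" using r by (simp add: power_divide field_simps)
      then have "K w = 0" unfolding K_def by (intro bumps_support[OF bump_in_bumps])
      then show ?thesis by simp
    qed
  qed
  also have "\<dots> = bump_mass r * e" using iK by (simp add: mass)
  finally have "cmod (mollify (bump r) f z - bump_mass r *\<^sub>R f z) \<le> bump_mass r * e" .
  moreover have "mollify (bump r) f z /\<^sub>R bump_mass r - f z = (mollify (bump r) f z - bump_mass r *\<^sub>R f z) /\<^sub>R bump_mass r"
    using c by (simp add: scaleR_diff_right)
  ultimately have "cmod (mollify (bump r) f z /\<^sub>R bump_mass r - f z) \<le> inverse (bump_mass r) * (bump_mass r * e)"
    using c by (simp only: norm_scaleR) (simp add: mult_left_mono)
  moreover have "inverse (bump_mass r) * (bump_mass r * e) = e" using c by simp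
  ultimately show ?thesis by (simp only:)
qed

text \<open>The partial derivatives of a mollification are the mollifications of the weak derivatives, so the cone
condition holds for them everywhere. They are also mollifications of \<open>f\<close> itself with the
derivatives of the kernel, which makes them continuous.\<close>

lemma smooth_approximation:
  assumes f: "continuous_on UNIV f" and wx: "weak_derivative 1 f fx" and wy: "weak_derivative \<i> f fy"
    and cone: "AE w in lebesgue. cmod (wirtinger_bar (fx w) (fy w)) \<le> k * Re (wirtinger (fx w) (fy w))"
  shows "\<exists>F Fx Fy :: nat \<Rightarrow> complex \<Rightarrow> complex.
    (\<forall>n z. (F n has_derivative (\<lambda>h. Re h *\<^sub>R Fx n z + Im h *\<^sub>R Fy n z)) (at z)) \<and>
    (\<forall>n. continuous_on UNIV (Fx n) \<and> continuous_on UNIV (Fy n)) \<and>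
    (\<forall>n z. cmod (wirtinger_bar (Fx n z) (Fy n z)) \<le> k * Re (wirtinger (Fx n z) (Fy n z))) \<and>
    (\<forall>z. (\<lambda>n. F n z) \<longlonglongrightarrow> f z)"
proof -
  \<comment> \<open>the kernel \<open>bump (r n)\<close> lives on the disc of radius \<open>1 / (n + 1)\<close>\<close>
  define r where "r = (\<lambda>n. (real (Suc n))\<^sup>2)"
  have r: "r n > 0" for n by (simp add: r_def)
  have L: "L1_loc f" "L1_loc fx" "L1_loc fy" using wx wy by (auto simp: weak_derivative_def)
  have c: "bump_mass (r n) > 0" for n by (rule bump_mass_pos[OF r])
  define M where "M = (\<lambda>n g z. mollify (bump (r n)) g z /\<^sub>R bump_mass (r n))"
  have der: "(M n f has_derivative (\<lambda>h. Re h *\<^sub>R M n fx z + Im h *\<^sub>R M n fy z)) (at z)"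
    and cont: "continuous_on UNIV (M n fx)" "continuous_on UNIV (M n fy)" for n z
  proof -
    obtain Kx Ky where K: "Kx \<in> bumps (r n)" "Ky \<in> bumps (r n)"
      "\<And>w. (bump (r n) has_derivative (\<lambda>h. Re h * Kx w + Im h * Ky w)) (at w)"
      using bumps_derivative[OF bump_in_bumps[of "r n"]] by blast
    have x: "mollify Kx f y = - mollify (bump (r n)) fx y" for y
      using mollify_weak_derivative[OF bump_in_bumps r K(3) wx, of y] by simp
    have y: "mollify Ky f y = - mollify (bump (r n)) fy y" for y
      using mollify_weak_derivative[OF bump_in_bumps r K(3) wy, of y] by simp
    have "(mollify (bump (r n)) f has_derivative (\<lambda>h. Re h *\<^sub>R mollify (bump (r n)) fx z + Im h *\<^sub>R mollify (bump (r n)) fy z)) (at z)"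
      using mollify_has_derivative[OF bump_in_bumps K(1,2) r K(3) f, of z] by (simp add: x y add.commute)
    from has_derivative_scaleR_right[OF this, of "inverse (bump_mass (r n))"]
    show "(M n f has_derivative (\<lambda>h. Re h *\<^sub>R M n fx z + Im h *\<^sub>R M n fy z)) (at z)"
      unfolding M_def by (rule has_derivative_eq_rhs) (simp add: fun_eq_iff scaleR_add_right mult.commute)
    have cm: "continuous_on UNIV (mollify k f)" if k: "k \<in> bumps (r n)" for k
    proof -
      obtain kx ky where "kx \<in> bumps (r n)" "ky \<in> bumps (r n)"
        "\<And>w. (k has_derivative (\<lambda>h. Re h * kx w + Im h * ky w)) (at w)"
        using bumps_derivative[OF k] by blast
      from mollify_has_derivative[OF k this(1,2) r this(3) f]
      show ?thesis by (intro continuous_at_imp_continuous_on ballI has_derivative_continuous)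
    qed
    have "mollify (bump (r n)) fx = (\<lambda>y. - mollify Kx f y)" "mollify (bump (r n)) fy = (\<lambda>y. - mollify Ky f y)"
      by (simp_all add: x y)
    then show "continuous_on UNIV (M n fx)" "continuous_on UNIV (M n fy)"
      unfolding M_def using cm[OF K(1)] cm[OF K(2)] by (auto intro!: continuous_intros)
  qed
  have "cmod (wirtinger_bar (M n fx z) (M n fy z)) \<le> k * Re (wirtinger (M n fx z) (M n fy z))" for n z
  proof -
    have "wirtinger_bar (M n fx z) (M n fy z) = wirtinger_bar (mollify (bump (r n)) fx z) (mollify (bump (r n)) fy z) /\<^sub>R bump_mass (r n)"
      "wirtinger (M n fx z) (M n fy z) = wirtinger (mollify (bump (r n)) fx z) (mollify (bump (r n)) fy z) /\<^sub>R bump_mass (r n)"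
      by (simp_all add: M_def wirtinger_bar_def wirtinger_def scaleR_conv_of_real algebra_simps)
    then show ?thesis
      using mult_left_mono[OF mollify_cone[OF r[of n] L(2,3) cone, of z], of "inverse (bump_mass (r n))"] c[of n]
      by (simp add: mult_ac)
  qed
  moreover have "(\<lambda>n. M n f z) \<longlonglongrightarrow> f z" for z
  proof (rule LIMSEQ_I)
    fix e :: real assume e: "0 < e"
    have "isCont f z" using f by (simp add: continuous_on_eq_continuous_at)
    then obtain d where d: "d > 0" "\<And>w. dist w z < d \<Longrightarrow> cmod (f w - f z) < e / 2"
      unfolding continuous_at_eps_delta using e by (metis dist_norm half_gt_zero)
    obtain N where N: "1 / d < real N" using reals_Archimedean2 by blast
    have "cmod (M n f z - f z) < e" if n: "n \<ge> N" for n
    proof -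
      have "1 / real (Suc n) < d" using N n d(1) by (simp add: field_simps) (smt (verit) mult_left_mono of_nat_mono)
      then have "cmod (f w - f z) \<le> e / 2" if "dist w z < 1 / sqrt (r n)" for w
        using that d(2)[of w] by (simp add: r_def)
      then have "cmod (M n f z - f z) \<le> e / 2" unfolding M_def by (intro mollify_close r L)
      then show ?thesis using e by simp
    qed
    then show "\<exists>no. \<forall>n\<ge>no. norm (M n f z - f z) < e" by blast
  qed
  ultimately show ?thesis using der cont
    by (intro exI[of _ "\<lambda>n. M n f"] exI[of _ "\<lambda>n. M n fx"] exI[of _ "\<lambda>n. M n fy"]) auto
qed

section \<open>Reduced quasiconformal maps\<close>

text \<open>The derivative of \<open>Re (cnj h * g)\<close> in the direction \<open>h\<close> is \<open>\<bar>h\<bar>\<^sup>2\<close> times the real part of the derivative of \<open>g\<close> with respect to \<open>z\<close>, up to a term of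
modulus at most \<open>\<bar>h\<bar>\<^sup>2\<close> times the modulus of the other Wirtinger derivative.\<close>

lemma strongly_monotone:
  fixes g gx gy :: "complex \<Rightarrow> complex"
  assumes der: "\<And>z. (g has_derivative (\<lambda>v. Re v *\<^sub>R gx z + Im v *\<^sub>R gy z)) (at z)"
    and cone: "\<And>z. cmod (wirtinger_bar (gx z) (gy z)) + d \<le> Re (wirtinger (gx z) (gy z))"
  shows "d * (cmod h)\<^sup>2 \<le> Re (cnj h * (g (c + h) - g c))"
proof -
  define D where "D = (\<lambda>t::real. Re (cnj h * (Re h *\<^sub>R gx (c + t *\<^sub>R h) + Im h *\<^sub>R gy (c + t *\<^sub>R h))))"
  have dg: "((\<lambda>t. Re (cnj h * g (c + t *\<^sub>R h))) has_real_derivative D t) (at t)" for t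
  proof -
    have "((\<lambda>t. c + t *\<^sub>R h) has_derivative (\<lambda>x. x *\<^sub>R h)) (at t)" by (auto intro!: derivative_eq_intros)
    from has_derivative_Re[OF has_derivative_mult_right[OF has_derivative_compose[OF this der], of "cnj h"]]
    show ?thesis unfolding has_field_derivative_def
      by (rule has_derivative_eq_rhs) (simp add: D_def fun_eq_iff algebra_simps)
  qed
  have D: "d * (cmod h)\<^sup>2 \<le> D t" for t
  proof -
    let ?x = "gx (c + t *\<^sub>R h)" and ?y = "gy (c + t *\<^sub>R h)"
    have "cnj h * (Re h *\<^sub>R ?x + Im h *\<^sub>R ?y) = of_real ((cmod h)\<^sup>2) * wirtinger ?x ?y + wirtinger_bar ?x ?y * (cnj h)\<^sup>2"
      unfolding cmod_power2
      by (auto simp: complex_eq_iff wirtinger_def wirtinger_bar_def power2_eq_square field_simps)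
    moreover have "Re (complex_of_real x * w + y) = x * Re w + Re y" for x w y by simp
    ultimately have "D t = (cmod h)\<^sup>2 * Re (wirtinger ?x ?y) + Re (wirtinger_bar ?x ?y * (cnj h)\<^sup>2)"
      unfolding D_def by (simp only:)
    moreover have "- (cmod (wirtinger_bar ?x ?y) * (cmod h)\<^sup>2) \<le> Re (wirtinger_bar ?x ?y * (cnj h)\<^sup>2)"
      using abs_Re_le_cmod[of "wirtinger_bar ?x ?y * (cnj h)\<^sup>2"] by (simp add: norm_mult norm_power)
    moreover have "(cmod h)\<^sup>2 * (cmod (wirtinger_bar ?x ?y) + d) \<le> (cmod h)\<^sup>2 * Re (wirtinger ?x ?y)"
      by (intro mult_left_mono cone) auto
    ultimately show ?thesis by (simp add: algebra_simps)
  qed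
  have "\<exists>t>0. t < 1 \<and> Re (cnj h * g (c + 1 *\<^sub>R h)) - Re (cnj h * g (c + 0 *\<^sub>R h)) = (1 - 0) * D t"
    by (intro MVT2 dg) auto
  then obtain t where "Re (cnj h * g (c + h)) - Re (cnj h * g c) = D t" by auto
  then show ?thesis using D[of t] by (simp add: right_diff_distrib)
qed

text \<open>Adding \<open>(d + \<i> * b) * z\<close> does not change the derivative with respect to the conjugate variable and adds
\<open>d\<close> to the real part of the other one. So the sum is strongly monotone, hence injective, and its
dilatation has a bound that does not depend on \<open>b\<close>. This independence of the rotation \<open>b\<close> is what
distinguishes the reduced equation from the general Beltrami equation.\<close>

lemma rotated_quasisymmetry:
  fixes F Fx Fy :: "complex \<Rightarrow> complex"
  assumes der: "\<And>z. (F has_derivative (\<lambda>v. Re v *\<^sub>R Fx z + Im v *\<^sub>R Fy z)) (at z)"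
    and cont: "continuous_on UNIV Fx" "continuous_on UNIV Fy" and k: "0 < k" "k < 1"
    and cone: "\<And>z. cmod (wirtinger_bar (Fx z) (Fy z)) \<le> k * Re (wirtinger (Fx z) (Fy z))"
    and d: "d > 0"
  shows "cmod (F c - F (c - h) + Complex d b * h) \<le> exp (8 * pi\<^sup>2 * ((1+k)/(1-k)) / ln 2) * cmod (F (c + h) - F c + Complex d b * h)"
proof -
  define l where "l = Complex d b"
  define g where "g = (\<lambda>z. F z + l * z)"
  define gx where "gx = (\<lambda>z. Fx z + l)"
  define gy where "gy = (\<lambda>z. Fy z + \<i> * l)"
  have dg: "(g has_derivative (\<lambda>v. Re v *\<^sub>R gx z + Im v *\<^sub>R gy z)) (at z)" for z
  proof -
    have "((\<lambda>z. l * z) has_derivative (\<lambda>v. l * v)) (at z)" by (auto intro!: derivative_eq_intros)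
    from has_derivative_add[OF der this] show ?thesis unfolding g_def
      by (rule has_derivative_eq_rhs) (auto simp: gx_def gy_def fun_eq_iff complex_eq_iff algebra_simps)
  qed
  have wb: "wirtinger_bar (gx z) (gy z) = wirtinger_bar (Fx z) (Fy z)" for z
    by (simp add: wirtinger_bar_def gx_def gy_def algebra_simps)
  have w: "wirtinger (gx z) (gy z) = wirtinger (Fx z) (Fy z) + l" for z
    by (simp add: wirtinger_def gx_def gy_def field_simps)
  have R0: "0 \<le> Re (wirtinger (Fx z) (Fy z))" for z
  proof -
    have "0 \<le> k * Re (wirtinger (Fx z) (Fy z))" using cone[of z] norm_ge_zero order_trans by blast
    then show ?thesis using k by (simp add: zero_le_mult_iff)
  qed
  have "inj g"
  proof (rule injI, rule ccontr)
    fix x y assume xy: "g x = g y" "x \<noteq> y"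
    have "d * (cmod (y - x))\<^sup>2 \<le> Re (cnj (y - x) * (g (x + (y - x)) - g x))"
    proof (rule strongly_monotone[OF dg])
      fix z
      have "k * Re (wirtinger (Fx z) (Fy z)) \<le> 1 * Re (wirtinger (Fx z) (Fy z))"
        using k R0 by (intro mult_right_mono) auto
      then show "cmod (wirtinger_bar (gx z) (gy z)) + d \<le> Re (wirtinger (gx z) (gy z))"
        using cone[of z] by (simp add: wb w l_def)
    qed
    then show False using xy d by (simp add: mult_le_0_iff)
  qed
  moreover have "cmod (wirtinger_bar (gx z) (gy z)) \<le> k * cmod (wirtinger (gx z) (gy z))" for z
  proof -
    have "Re (wirtinger (Fx z) (Fy z)) \<le> Re (wirtinger (gx z) (gy z))" using d by (simp add: w l_def)
    also have "\<dots> \<le> cmod (wirtinger (gx z) (gy z))" by (rule complex_Re_le_cmod)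
    finally show ?thesis using cone[of z] k unfolding wb by (meson mult_left_mono less_imp_le order_trans)
  qed
  moreover have "continuous_on UNIV gx" "continuous_on UNIV gy"
    unfolding gx_def gy_def by (intro continuous_intros cont)+
  ultimately have "cmod (g (c - h) - g c) \<le> exp (8 * pi\<^sup>2 * ((1+k)/(1-k)) / ln 2) * cmod (g (c + h) - g c)"
    using k by (intro weak_quasisymmetry[OF dg]) auto
  moreover have "g (c - h) - g c = - (F c - F (c - h) + l * h)" "g (c + h) - g c = F (c + h) - F c + l * h"
    by (simp_all add: g_def algebra_simps)
  ultimately show ?thesis unfolding l_def[symmetric] by (simp only: norm_minus_cancel)
qed

text \<open>On the line through \<open>a\<close> and \<open>b\<close> let \<open>P\<close> and \<open>Q\<close> be increments of the map over two adjacent intervals of equal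
length, with the direction of the line as the real axis. The parameter of the quasisymmetry inequality is
chosen such that the imaginary part of \<open>P\<close> is cancelled. Then the right-hand side is \<open>H * Re P\<close>, and the left-hand side is the
modulus of \<open>Q - \<i> * Im P\<close>: its real part gives the doubling condition, its imaginary part the Zygmund condition.\<close>

lemma finite_variation_on_segmentI:
  fixes f :: "complex \<Rightarrow> complex"
  assumes f: "continuous_on UNIV f" and H: "H > 1" and q: "q > 1"
    and mono: "\<And>c h. 0 \<le> Re (cnj h * (f (c + h) - f c))"
    and qs: "\<And>c h b. cmod (f c - f (c - h) + \<i> * of_real b * h) \<le> H * cmod (f (c + h) - f c + \<i> * of_real b * h)"
    and ab: "a \<noteq> b"
  shows "finite_variation_on_segment (log_gauge q) f a b"
proof -
  define d where "d = cmod (b - a)"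
  define e where "e = (b - a) /\<^sub>R d"
  have d: "d > 0" using ab by (simp add: d_def)
  have e1: "cmod e = 1" using d by (simp add: e_def d_def)
  have ba: "b - a = d *\<^sub>R e" using d by (simp add: e_def)
  have ee: "cnj e * e = 1" using e1 by (metis complex_norm_square mult.commute of_real_1 power_one)
  define p where "p = (\<lambda>t::real. a + t *\<^sub>R (b - a))"
  define g where "g = (\<lambda>t. cnj e * f (p t))"
  define u where "u = (\<lambda>t. Re (g t))"
  define v where "v = (\<lambda>t. Im (g t))"
  have cg: "continuous_on UNIV g"
    unfolding g_def p_def by (intro continuous_intros continuous_on_compose2[OF f]) auto
  have umono: "mono u"
  proof (rule monoI)
    fix s t :: real assume st: "s \<le> t"
    have "0 \<le> Re (cnj ((t - s) *\<^sub>R (b - a)) * (f (p s + (t - s) *\<^sub>R (b - a)) - f (p s)))" by (rule mono)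
    also have "p s + (t - s) *\<^sub>R (b - a) = p t" by (simp add: p_def algebra_simps)
    also have "Re (cnj ((t - s) *\<^sub>R (b - a)) * (f (p t) - f (p s))) = (t - s) * d * (u t - u s)"
      unfolding ba by (simp add: u_def g_def algebra_simps)
    finally have prod: "0 \<le> (t - s) * d * (u t - u s)" .
    show "u s \<le> u t"
    proof (cases "s = t")
      case False
      then have "0 < (t - s) * d" using st d by simp
      then show ?thesis using mult_left_le_imp_le[of "(t - s) * d" 0 "u t - u s"] prod by simp
    qed simp
  qed
  have "zygmund_pair H u v"
    unfolding zygmund_pair_def
  proof (intro conjI allI impI umono)
    show "continuous_on UNIV u" "continuous_on UNIV v" unfolding u_def v_def by (intro continuous_intros cg)+
    fix t s :: real assume s: "0 \<le> s"
    define P where "P = g (t + 2 * s) - g (t + s)"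
    define Q where "Q = g (t + s) - g t"
    have RP: "0 \<le> Re P" unfolding P_def using monoD[OF umono, of "t+s" "t+2 * s"] s by (simp add: u_def)
    have "cmod (Q - \<i> * of_real (Im P)) \<le> H * Re P"
    proof (cases "s = 0")
      case True
      then show ?thesis by (simp add: P_def Q_def)
    next
      case False
      then have s0: "s > 0" using s by simp
      define h where "h = s *\<^sub>R (b - a)"
      define r where "r = - Im P / (s * d)"
      have pts: "p (t + s) - h = p t" "p (t + s) + h = p (t + 2 * s)"
        by (simp_all add: p_def h_def scaleR_conv_of_real algebra_simps)
      have eh: "cnj e * (\<i> * of_real r * h) = - \<i> * of_real (Im P)"
      proof -
        have "cnj e * (\<i> * of_real r * h) = \<i> * of_real (r * (s * d)) * (cnj e * e)"
          unfolding h_def ba by (simp add: scaleR_conv_of_real)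
        then show ?thesis using s0 d by (simp add: ee r_def)
      qed
      have "cmod (cnj e) * cmod (f (p (t+s)) - f (p t) + \<i> * of_real r * h) \<le> H * (cmod (cnj e) * cmod (f (p (t + 2 * s)) - f (p (t+s)) + \<i> * of_real r * h))"
        using qs[of "p (t+s)" h r] unfolding pts by (simp add: e1)
      moreover have "cnj e * (f (p (t+s)) - f (p t) + \<i> * of_real r * h) = Q - \<i> * of_real (Im P)"
        unfolding distrib_left eh by (simp add: Q_def g_def right_diff_distrib)
      moreover have "cnj e * (f (p (t + 2 * s)) - f (p (t+s)) + \<i> * of_real r * h) = P - \<i> * of_real (Im P)"
        unfolding distrib_left eh by (simp add: P_def g_def right_diff_distrib)
      moreover have "P - \<i> * of_real (Im P) = of_real (Re P)" by (simp add: complex_eq_iff)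
      ultimately have "cmod (Q - \<i> * of_real (Im P)) \<le> H * cmod (complex_of_real (Re P))"
        unfolding norm_mult[symmetric] by simp
      then show ?thesis using RP by simp
    qed
    note key = this
    have "Re Q \<le> H * Re P" using complex_Re_le_cmod[of "Q - \<i> * of_real (Im P)"] key by simp
    then show "u (t + s) - u t \<le> H * (u (t + 2 * s) - u (t + s))" by (simp add: u_def P_def Q_def)
    have "\<bar>Im Q - Im P\<bar> \<le> H * Re P" using abs_Im_le_cmod[of "Q - \<i> * of_real (Im P)"] key by simp
    moreover have "H * Re P \<le> H * (u (t + 2 * s) - u t)"
      using H s monoD[OF umono, of t "t+s"] by (intro mult_left_mono) (auto simp: P_def u_def)
    ultimately have "\<bar>Im Q - Im P\<bar> \<le> H * (u (t + 2 * s) - u t)" by linarith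
    moreover have "v (t + 2 * s) - 2 * v (t + s) + v t = - (Im Q - Im P)" by (simp add: v_def P_def Q_def)
    ultimately show "\<bar>v (t + 2 * s) - 2 * v (t + s) + v t\<bar> \<le> H * (u (t + 2 * s) - u t)"
      by (simp only: abs_minus_cancel)
  qed
  from zygmund_pair_finite_variation[OF this H q] obtain B where B: "\<And>n t. unit_partition n t \<Longrightarrow>
    (\<Sum>j=1..n. log_gauge q (cmod (Complex (u (t j)) (v (t j)) - Complex (u (t (j-1))) (v (t (j-1)))))) \<le> B"
    by blast
  have inc: "cmod (Complex (u s) (v s) - Complex (u t) (v t)) = cmod (f (p s) - f (p t))" for s t
  proof -
    have "Complex (u s) (v s) - Complex (u t) (v t) = cnj e * (f (p s) - f (p t))"
      by (simp add: u_def v_def g_def complex_eq_iff algebra_simps)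
    then show ?thesis using e1 by (simp add: norm_mult)
  qed
  show ?thesis unfolding finite_variation_on_segment_def
  proof (rule bdd_aboveI[of _ B])
    fix x assume "x \<in> {\<Sum>j=1..N. log_gauge q (cmod (f (a + t j *\<^sub>R (b - a)) - f (a + t (j - 1) *\<^sub>R (b - a)))) | N t. unit_partition N t}"
    then obtain N t where "unit_partition N t"
      and x: "x = (\<Sum>j=1..N. log_gauge q (cmod (f (a + t j *\<^sub>R (b - a)) - f (a + t (j - 1) *\<^sub>R (b - a)))))"
      by blast
    from B[OF this(1)] show "x \<le> B" unfolding x inc p_def .
  qed
qed

text \<open>Both inequalities are closed conditions. Monotonicity passes from the smooth approximations \<open>F n\<close> to \<open>f\<close>,
quasisymmetry from \<open>F n + (1 / (n + 1) + \<i> * b) * z\<close> to \<open>f + \<i> * b * z\<close>.\<close>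

lemma reduced_quasiconformal_quasisymmetry:
  assumes "reduced_quasiconformal f"
  obtains H where "H > 1" "continuous_on UNIV f"
    "\<And>c h. 0 \<le> Re (cnj h * (f (c + h) - f c))"
    "\<And>c h b. cmod (f c - f (c - h) + \<i> * of_real b * h) \<le> H * cmod (f (c + h) - f c + \<i> * of_real b * h)"
proof -
  from assms obtain g fx fy k where hom: "homeomorphism UNIV UNIV f g" and W: "W12_loc_with f fx fy"
    and k: "0 < k" "k < 1"
    and cone: "AE z in lebesgue. cmod (wirtinger_bar (fx z) (fy z)) \<le> k * Re (wirtinger (fx z) (fy z))"
    unfolding reduced_quasiconformal_def by blast
  have cf: "continuous_on UNIV f" using hom by (simp add: homeomorphism_def)
  have "weak_derivative 1 f fx" "weak_derivative \<i> f fy" using W by (auto simp: W12_loc_with_def)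
  from smooth_approximation[OF cf this cone] obtain F Fx Fy where
    der: "\<And>n z. (F n has_derivative (\<lambda>h. Re h *\<^sub>R Fx n z + Im h *\<^sub>R Fy n z)) (at z)"
    and cont: "\<And>n. continuous_on UNIV (Fx n)" "\<And>n. continuous_on UNIV (Fy n)"
    and coneF: "\<And>n z. cmod (wirtinger_bar (Fx n z) (Fy n z)) \<le> k * Re (wirtinger (Fx n z) (Fy n z))"
    and lim: "\<And>z. (\<lambda>n. F n z) \<longlonglongrightarrow> f z" by blast
  define H where "H = exp (8 * pi\<^sup>2 * ((1+k)/(1-k)) / ln 2)"
  have "H > 1" using k by (simp add: H_def)
  moreover have "0 \<le> Re (cnj h * (f (c + h) - f c))" for c h
  proof (rule LIMSEQ_le_const)
    show "(\<lambda>n. Re (cnj h * (F n (c + h) - F n c))) \<longlonglongrightarrow> Re (cnj h * (f (c + h) - f c))"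
      by (intro tendsto_intros lim)
    have "0 * (cmod h)\<^sup>2 \<le> Re (cnj h * (F n (c + h) - F n c))" for n
    proof (rule strongly_monotone[OF der])
      fix z
      have "0 \<le> k * Re (wirtinger (Fx n z) (Fy n z))" using coneF[of n z] norm_ge_zero order_trans by blast
      then have "0 \<le> Re (wirtinger (Fx n z) (Fy n z))" using k by (simp add: zero_le_mult_iff)
      then have "k * Re (wirtinger (Fx n z) (Fy n z)) \<le> 1 * Re (wirtinger (Fx n z) (Fy n z))"
        using k by (intro mult_right_mono) auto
      then show "cmod (wirtinger_bar (Fx n z) (Fy n z)) + 0 \<le> Re (wirtinger (Fx n z) (Fy n z))"
        using coneF[of n z] by simp
    qed
    then show "\<exists>N. \<forall>n\<ge>N. 0 \<le> Re (cnj h * (F n (c + h) - F n c))" by simp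
  qed
  moreover have "cmod (f c - f (c - h) + \<i> * of_real b * h) \<le> H * cmod (f (c + h) - f c + \<i> * of_real b * h)" for c h b
  proof (rule LIMSEQ_le)
    have "(\<lambda>n. complex_of_real (1 / real (Suc n)) + \<i> * of_real b) \<longlonglongrightarrow> of_real 0 + \<i> * of_real b"
      by (intro tendsto_intros LIMSEQ_Suc[OF lim_1_over_n[where 'a=real]])
    moreover have "complex_of_real (1 / real (Suc n)) + \<i> * of_real b = Complex (1 / real (Suc n)) b" for n
      by (simp add: complex_eq_iff)
    ultimately have l: "(\<lambda>n. Complex (1 / real (Suc n)) b) \<longlonglongrightarrow> \<i> * of_real b" by simp
    show "(\<lambda>n. cmod (F n c - F n (c - h) + Complex (1 / real (Suc n)) b * h)) \<longlonglongrightarrow> cmod (f c - f (c - h) + \<i> * of_real b * h)"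
      by (intro tendsto_intros lim l)
    show "(\<lambda>n. H * cmod (F n (c + h) - F n c + Complex (1 / real (Suc n)) b * h)) \<longlonglongrightarrow> H * cmod (f (c + h) - f c + \<i> * of_real b * h)"
      by (intro tendsto_intros lim l)
    show "\<exists>N. \<forall>n\<ge>N. cmod (F n c - F n (c - h) + Complex (1 / real (Suc n)) b * h) \<le> H * cmod (F n (c + h) - F n c + Complex (1 / real (Suc n)) b * h)"
      unfolding H_def using rotated_quasisymmetry[OF der cont k coneF] by simp
  qed
  ultimately show ?thesis using cf that by blast
qed

theorem theorem1p7:
  fixes f :: "complex \<Rightarrow> complex" and q :: real
  assumes "reduced_quasiconformal f"
    and "q > 1"
  shows "finite_variation_on_lines (log_gauge q) f UNIV"
proof -
  obtain H where "H > 1" "continuous_on UNIV f"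
    "\<And>c h. 0 \<le> Re (cnj h * (f (c + h) - f c))"
    "\<And>c h b. cmod (f c - f (c - h) + \<i> * of_real b * h) \<le> H * cmod (f (c + h) - f c + \<i> * of_real b * h)"
    using reduced_quasiconformal_quasisymmetry[OF assms(1)] by blast
  then show ?thesis
    unfolding finite_variation_on_lines_def using finite_variation_on_segmentI assms(2) by blast
qed

end
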